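(* In the setting described in the context, the sequence $(u_m)_{m\ge0}$ is almost surely not eventually constant. Moreover, for every realization in which $(u_m)_{m\ge0}$ is not eventually constant, the sequence $(z_m)_{m\ge0}$ converges in $\overline{\mathbb{H}}$ to some point $\zeta\in\overline{\mathbb{R}}$.
   Context: Let $\mathbb{H}=\{z\in\mathbb{C}:\operatorname{Im}z>0\}$ be the Poincaré upper half-plane (metric $(dx^2+dy^2)/y^2$), $\overline{\mathbb{R}}=\mathbb{R}\cup\{\infty\}$, and $\overline{\mathbb{H}}=\mathbb{H}\cup\overline{\mathbb{R}}$ (a closed disk). A (hyperbolic) line is a set $\{z\in\mathbb{H}:\operatorname{Re}z=x\}$ or $\{z\in\mathbb{H}:|z-x|=r\}$ with $x\in\mathbb{R}$, $r>0$; its reflection $t_L$ is $t_L(z)=2x-\bar z$, resp. $t_L(z)=r^2/(\bar z-x)+x$, extended continuously to $\overline{\mathbb{H}}$. Fix lines $L_1,L_2,L_3\subseteq\mathbb{H}$ and $z_0\in\mathbb{H}$ such that for all distinct $i,i'\in\{1,2,3\}$ either (a) $L_i\cap L_{i'}=\emptyset$ and $z_0$ lies in the connected component of $\mathbb{H}\setminus(L_i\cup L_{i'})$ whose boundary contains both lines, or (b) $L_i,L_{i'}$ meet at an angle of measure $\pi/m(i,i')$ with $m(i,i')\ge2$ an integer, and $z_0$ lies in the interior of that angle. Let $s_i=t_{L_i}$, let $W$ be the group generated by $S=\{s_1,s_2,s_3\}$ (a Coxeter system; $W$ is infinite and acts properly on $\mathbb{H}$), and let $\ell$ be the word length with respect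 to $S$. Let $i_1,i_2,\ldots$ be independent uniform random elements of $\{1,2,3\}$. Define $u_0=1$ and $u_{m+1}=u_m s_{i_{m+1}}$ if $\ell(u_ms_{i_{m+1}})>\ell(u_m)$, and $u_{m+1}=u_m$ otherwise (this is $u_m=s_{i_1}\star\cdots\star s_{i_m}$ for the Demazure product $\star$), and set $z_m=u_m(z_0)$. *)

theory Defs
  imports "HOL-Probability.Probability"
begin

definition upper :: "complex set" where
  "upper = {z. Im z > 0}"

datatype hline = Vert real | Circ real real

fun valid_line :: "hline \<Rightarrow> bool" where
  "valid_line (Vert x) = True"
| "valid_line (Circ x r) = (r > 0)"

fun line_set :: "hline \<Rightarrow> complex set" where
  "line_set (Vert x) = {z \<in> upper. Re z = x}"
| "line_set (Circ x r) = {z \<in> upper. cmod (z - complex_of_real x) = r}"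

fun refl :: "hline \<Rightarrow> complex \<Rightarrow> complex" where
  "refl (Vert x) z = 2 * complex_of_real x - cnj z"
| "refl (Circ x r) z = complex_of_real (r^2) / (cnj z - complex_of_real x) + complex_of_real x"

text \<open>A unit (Euclidean) tangent vector of the line at a point p on it; the other one is its negative.\<close>
fun line_tangent :: "hline \<Rightarrow> complex \<Rightarrow> complex" where
  "line_tangent (Vert x) p = \<i>"
| "line_tangent (Circ x r) p = \<i> * (p - complex_of_real x) / complex_of_real r"

definition cond_disjoint :: "hline \<Rightarrow> hline \<Rightarrow> complex \<Rightarrow> bool" where
  "cond_disjoint L L' z0 \<longleftrightarrow>
     line_set L \<inter> line_set L' = {} \<and>
     (\<exists>C \<in> components (upper - (line_set L \<union> line_set L')).
        z0 \<in> C \<and> line_set L \<subseteq> frontier C \<and> line_set L' \<subseteq> frontier C)"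

text \<open>Condition (b): the lines meet at a point p at an angle pi/m (m \<ge> 2 an integer) and z0 lies in
  the interior of that angle, i.e. in the component of the complement of the two lines which
  contains the initial part of the bisecting ray (direction d1 * cis(pi/(2m))) of the angle
  between unit tangent directions d1 (of L) and d2 (of L') with d2 = d1 * cis(pi/m), or the
  symmetric situation with the roles of d1 and d2 exchanged.  (Hyperbolic angles equal
  Euclidean angles since the metric is conformal.)\<close>
definition cond_angle :: "hline \<Rightarrow> hline \<Rightarrow> complex \<Rightarrow> bool" where
  "cond_angle L L' z0 \<longleftrightarrow>
     (\<exists>p (m::nat). m \<ge> 2 \<and> line_set L \<inter> line_set L' = {p} \<and>
       (\<exists>d1 \<in> {line_tangent L p, - line_tangent L p}.
        \<exists>d2 \<in> {line_tangent L' p, - line_tangent L' p}.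
          (d2 = d1 * cis (pi / real m) \<and>
             (\<forall>\<^sub>F \<epsilon> in at_right 0. p + complex_of_real \<epsilon> * d1 * cis (pi / (2 * real m))
                 \<in> connected_component_set (upper - (line_set L \<union> line_set L')) z0))
        \<or> (d1 = d2 * cis (pi / real m) \<and>
             (\<forall>\<^sub>F \<epsilon> in at_right 0. p + complex_of_real \<epsilon> * d2 * cis (pi / (2 * real m))
                 \<in> connected_component_set (upper - (line_set L \<union> line_set L')) z0))))"

fun act :: "(nat \<Rightarrow> hline) \<Rightarrow> nat list \<Rightarrow> complex \<Rightarrow> complex" where
  "act L [] z = z"
| "act L (a # w) z = refl (L a) (act L w z)"

text \<open>Two words represent the same group element iff they act identically on H.\<close>
definition same_elem :: "(nat \<Rightarrow> hline) \<Rightarrow> nat list \<Rightarrow> nat list \<Rightarrow> bool" where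
  "same_elem L w w' \<longleftrightarrow> (\<forall>z \<in> upper. act L w z = act L w' z)"

definition wlen :: "(nat \<Rightarrow> hline) \<Rightarrow> nat list \<Rightarrow> nat" where
  "wlen L w = (LEAST n. \<exists>w'. set w' \<subseteq> {1,2,3} \<and> length w' = n \<and> same_elem L w' w)"

fun demazure :: "(nat \<Rightarrow> hline) \<Rightarrow> (nat \<Rightarrow> nat) \<Rightarrow> nat \<Rightarrow> nat list" where
  "demazure L idx 0 = []"
| "demazure L idx (Suc m) =
     (if wlen L (demazure L idx m @ [idx (Suc m)]) > wlen L (demazure L idx m)
      then demazure L idx m @ [idx (Suc m)] else demazure L idx m)"

definition eventually_const_elem :: "(nat \<Rightarrow> hline) \<Rightarrow> (nat \<Rightarrow> nat list) \<Rightarrow> bool" where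
  "eventually_const_elem L u \<longleftrightarrow> (\<exists>N. \<forall>m \<ge> N. same_elem L (u m) (u N))"

text \<open>i_1, i_2, ... independent uniform on {1,2,3} (coordinate 0 unused).\<close>
definition index_space :: "(nat \<Rightarrow> nat) measure" where
  "index_space = (\<Pi>\<^sub>M k \<in> UNIV. measure_pmf (pmf_of_set {1,2,3::nat}))"

end

theory Submission
  imports Defs "HOL-Library.Sublist"
begin

text \<open>
  In the hyperboloid model the three lines have outward unit normals whose mutual Lorentz products
  are either at most \<open>-1\<close> or of the form \<open>- cos (\<pi>/m)\<close>. The argument of Tits with dihedral
  subgroups shows that \<open>\<ell> (w s\<^sub>i) > \<ell> w\<close> holds exactly when the root \<open>w (r i)\<close> points away from
  the base point.

  No \<open>w\<close> has all generators as descents: there are more roots than space dimensions, so some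
  nonnegative combination of them is causal, and a causal vector cannot change sign on the
  hyperboloid. Hence the process almost surely never stops.

  Along an infinite reduced word let \<open>\<gamma>\<^sub>k\<close> be the root of the wall crossed at step \<open>k\<close>. Two such
  walls are both crossed for good, so \<open>\<gamma>\<^sub>j + \<gamma>\<^sub>k\<close> is not causal and the product of \<open>\<gamma>\<^sub>j\<close> and \<open>\<gamma>\<^sub>k\<close>
  exceeds \<open>-1\<close>. Writing \<open>\<gamma>\<^sub>k = h\<^sub>k (1, p\<^sub>k)\<close>, this says \<open>\<bar>p\<^sub>j - p\<^sub>k\<bar> \<le> 1/h\<^sub>j + 1/h\<^sub>k\<close>. Discreteness of
  the orbit gives \<open>h\<^sub>k \<rightarrow> \<infinity>\<close>, so \<open>p\<^sub>k\<close> converges to a boundary point, and the orbit, which stays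
  at bounded distance from the walls being crossed, converges to the same point.
\<close>

section \<open>Lorentzian geometry\<close>

definition lorentz :: "real \<times> 'a::real_inner \<Rightarrow> real \<times> 'a \<Rightarrow> real" where
  "lorentz u v = snd u \<bullet> snd v - fst u * fst v"

lemma lorentz_eq_inner: "lorentz u v = (- fst u, snd u) \<bullet> v"
  by (simp add: lorentz_def inner_prod_def)

interpretation lorentz: bounded_bilinear "lorentz :: real \<times> 'a::real_inner \<Rightarrow> real \<times> 'a \<Rightarrow> real"
proof
  have "norm (lorentz u v) \<le> norm u * norm v * 1" for u v :: "real \<times> 'a"
    using Cauchy_Schwarz_ineq2[of "(- fst u, snd u)" v]
    by (simp add: lorentz_eq_inner norm_prod_def)
  then show "\<exists>K. \<forall>u v :: real \<times> 'a. norm (lorentz u v) \<le> norm u * norm v * K" by blast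
qed (simp_all add: lorentz_def inner_left_distrib inner_right_distrib algebra_simps)

lemmas lorentz_simps [simp] =
  lorentz.add_left lorentz.add_right lorentz.diff_left lorentz.diff_right
  lorentz.minus_left lorentz.minus_right lorentz.scaleR_left lorentz.scaleR_right

lemma lorentz_base [simp]: "lorentz v (1, 0) = - fst v" "lorentz (1, 0) v = - fst v"
  by (simp_all add: lorentz_def)

lemma lorentz_commute: "lorentz u v = lorentz v u"
  by (simp add: lorentz_def inner_commute mult.commute)

lemma lorentz_self: "lorentz u u = (norm (snd u))\<^sup>2 - (fst u)\<^sup>2"
  unfolding lorentz_def power2_norm_eq_inner by (simp add: power2_eq_square)

definition hyperboloid :: "(real \<times> 'a::real_inner) set" where
  "hyperboloid = {v. lorentz v v = -1 \<and> fst v > 0}"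

lemma base_mem_hyperboloid [simp]: "(1, 0) \<in> hyperboloid"
  by (simp add: hyperboloid_def)

lemma norm_snd_hyperboloid_sq: "v \<in> hyperboloid \<Longrightarrow> (norm (snd v))\<^sup>2 = (fst v)\<^sup>2 - 1"
  by (simp add: hyperboloid_def lorentz_self)

lemma norm_snd_less_fst:
  assumes "v \<in> hyperboloid"
  shows "norm (snd v) < fst v"
  by (rule power2_less_imp_less) (use assms in \<open>auto simp: norm_snd_hyperboloid_sq hyperboloid_def\<close>)

lemma lorentz_causal_neg:
  assumes "lorentz d d \<le> 0" "fst d > 0" "v \<in> hyperboloid"
  shows "lorentz d v < 0"
proof -
  have d: "norm (snd d) \<le> fst d"
    by (rule power2_le_imp_le) (use assms(1,2) in \<open>auto simp: lorentz_self\<close>)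
  have "snd d \<bullet> snd v \<le> norm (snd d) * norm (snd v)"
    by (rule norm_cauchy_schwarz)
  also have "\<dots> \<le> fst d * norm (snd v)"
    using d by (simp add: mult_right_mono)
  also have "\<dots> < fst d * fst v"
    using norm_snd_less_fst[OF assms(3)] assms(2) by simp
  finally show ?thesis by (simp add: lorentz_def)
qed

lemma lorentz_causal_constant_sign:
  assumes d: "lorentz d d \<le> 0" and uv: "u \<in> hyperboloid" "v \<in> hyperboloid"
    and neg: "lorentz d u < 0"
  shows "lorentz d v < 0"
proof (cases "fst d" "0 :: real" rule: linorder_cases)
  case less
  then have "lorentz (- d) u < 0" by (intro lorentz_causal_neg) (use d uv in auto)
  then show ?thesis using neg by simp
next
  case equal
  then have "snd d = 0" using d by (simp add: lorentz_self)
  then show ?thesis using equal neg by (simp add: lorentz_def)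
next
  case greater
  then show ?thesis using d uv by (intro lorentz_causal_neg)
qed

text \<open>The difference \<open>a - b\<close> is not causal, since it takes opposite signs at \<open>p\<close> and \<open>p'\<close>.\<close>
lemma lorentz_less_one_if_separated:
  assumes "lorentz a a = 1" "lorentz b b = 1" and hyp: "p \<in> hyperboloid" "p' \<in> hyperboloid"
    and p: "lorentz a p = 0" "lorentz b p < 0" and p': "lorentz a p' < 0" "lorentz b p' = 0"
  shows "lorentz a b < 1"
proof (rule ccontr)
  assume "\<not> lorentz a b < 1"
  then have "lorentz (a - b) (a - b) \<le> 0" using assms(1,2) by (simp add: lorentz_commute[of b a])
  moreover have "lorentz (a - b) p' < 0" using p' by simp
  ultimately have "lorentz (a - b) p < 0" using lorentz_causal_constant_sign hyp by blast
  then show False using p by simp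
qed

definition reflect :: "real \<times> 'a::real_inner \<Rightarrow> real \<times> 'a \<Rightarrow> real \<times> 'a" where
  "reflect a v = v - (2 * lorentz v a) *\<^sub>R a"

lemma linear_reflect: "linear (reflect a)"
  by (rule linearI) (simp_all add: reflect_def algebra_simps)

lemma reflect_reflect [simp]: "lorentz a a = 1 \<Longrightarrow> reflect a (reflect a v) = v"
  by (simp add: reflect_def algebra_simps)

lemma lorentz_reflect_self: "lorentz a a = 1 \<Longrightarrow> lorentz a (reflect a v) = - lorentz a v"
  by (simp add: reflect_def lorentz_commute[of v a])

lemma reflect_self: "lorentz a a = 1 \<Longrightarrow> reflect a a = - a"
  by (simp add: reflect_def scaleR_2)

lemma lorentz_reflect: "lorentz a a = 1 \<Longrightarrow> lorentz (reflect a u) (reflect a v) = lorentz u v"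
  by (simp add: reflect_def algebra_simps lorentz_commute)

lemma reflect_mem_hyperboloid:
  assumes "lorentz a a = 1" "v \<in> hyperboloid"
  shows "reflect a v \<in> hyperboloid"
proof -
  have unit: "lorentz (reflect a v) (reflect a v) = -1"
    using assms by (simp add: lorentz_reflect hyperboloid_def)
  have "lorentz (reflect a v) v = - 1 - 2 * (lorentz v a)\<^sup>2"
    using assms by (simp add: reflect_def hyperboloid_def power2_eq_square lorentz_commute[of a v])
  also have "\<dots> < 0" using zero_le_power2[of "lorentz v a"] by linarith
  finally have "lorentz (reflect a v) (1, 0) < 0"
    by (rule lorentz_causal_constant_sign[rotated 3]) (use unit assms(2) in auto)
  then show ?thesis using unit by (simp add: hyperboloid_def)
qed

lemma norm_le_two_fst_if_hyperboloid:
  assumes "v \<in> hyperboloid"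
  shows "norm v \<le> 2 * fst v"
proof -
  have "norm v \<le> norm (fst v) + norm (snd v)"
    using norm_Pair_le[of "fst v" "snd v"] by simp
  then show ?thesis using norm_snd_less_fst[OF assms] assms by (simp add: hyperboloid_def)
qed

lemma fst_sq_gt_if_beyond_wall:
  assumes a: "lorentz a a = 1" "fst a > 0" and v: "v \<in> hyperboloid" and beyond: "lorentz a v > 0"
  shows "(fst v)\<^sup>2 > 1 + (fst a)\<^sup>2"
proof -
  have "0 < fst a * fst v" using a v by (simp add: hyperboloid_def)
  moreover have "fst a * fst v < norm (snd a) * norm (snd v)"
    using beyond norm_cauchy_schwarz[of "snd a" "snd v"] by (simp add: lorentz_def)
  ultimately have "(fst a * fst v)\<^sup>2 < (norm (snd a) * norm (snd v))\<^sup>2"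
    by (intro power_strict_mono) auto
  also have "\<dots> = (1 + (fst a)\<^sup>2) * ((fst v)\<^sup>2 - 1)"
  proof -
    have "(norm (snd a))\<^sup>2 = 1 + (fst a)\<^sup>2" using a(1) by (simp add: lorentz_self)
    then show ?thesis using v by (simp add: power_mult_distrib norm_snd_hyperboloid_sq)
  qed
  finally show ?thesis by (simp add: algebra_simps)
qed

lemma linear_eq_if_eq_on_hyperboloid:
  fixes f g :: "real \<times> 'a::real_inner \<Rightarrow> 'b::real_vector"
  assumes "linear f" "linear g" and eq: "\<And>v. v \<in> hyperboloid \<Longrightarrow> f v = g v"
  shows "f = g"
proof
  fix v :: "real \<times> 'a"
  define h where "h = sqrt (1 + (norm (snd v))\<^sup>2)"
  have "0 < 1 + (norm (snd v))\<^sup>2" by (simp add: add_pos_nonneg)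
  then have "(h, snd v) \<in> hyperboloid"
    by (simp add: h_def hyperboloid_def lorentz_self)
  then have "f (h, snd v) = g (h, snd v)" "f (1, 0) = g (1, 0)"
    by (auto intro: eq)
  moreover have decompose: "k v = k (h, snd v) + (fst v - h) *\<^sub>R k (1, 0)"
    if "linear k" for k :: "real \<times> 'a \<Rightarrow> 'b"
    using linear_add[OF that, of "(h, snd v)" "(fst v - h) *\<^sub>R (1, 0)"]
    unfolding linear_scale[OF that] by simp
  ultimately show "f v = g v"
    by (simp add: decompose[OF assms(1)] decompose[OF assms(2)])
qed

lemma orthogonal_decomposition:
  assumes unit: "lorentz a a = 1" "lorentz b b = 1" and "(lorentz a b)\<^sup>2 \<noteq> 1"
  obtains p x y where "v = p + x *\<^sub>R a + y *\<^sub>R b" "lorentz p a = 0" "lorentz p b = 0"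
proof
  define g where "g = lorentz a b"
  define x where "x = (lorentz v a - g * lorentz v b) / (1 - g\<^sup>2)"
  define y where "y = (lorentz v b - g * lorentz v a) / (1 - g\<^sup>2)"
  have "1 - g\<^sup>2 \<noteq> 0" using assms(3) by (simp add: g_def)
  then have "x + g * y = lorentz v a" "g * x + y = lorentz v b"
    by (simp_all add: x_def y_def divide_simps) (simp_all add: algebra_simps power2_eq_square)
  then show "lorentz (v - x *\<^sub>R a - y *\<^sub>R b) a = 0" "lorentz (v - x *\<^sub>R a - y *\<^sub>R b) b = 0"
    using unit by (simp_all add: g_def lorentz_commute[of b a] algebra_simps)
  show "v = (v - x *\<^sub>R a - y *\<^sub>R b) + x *\<^sub>R a + y *\<^sub>R b" by simp
qed

lemma nontrivial_linear_relation:
  fixes f :: "'i \<Rightarrow> 'a::euclidean_space"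
  assumes "finite I" "card I > DIM('a)"
  obtains c where "\<exists>i\<in>I. c i \<noteq> 0" "(\<Sum>i\<in>I. c i *\<^sub>R f i) = 0"
proof (cases "inj_on f I")
  case True
  then have "dependent (f ` I)"
    using assms by (intro dependent_biggerset) (simp add: card_image)
  then obtain u where "\<exists>v\<in>f ` I. u v \<noteq> 0" "(\<Sum>v\<in>f ` I. u v *\<^sub>R v) = 0"
    using dependent_finite[of "f ` I"] assms(1) by auto
  then show ?thesis using that[of "u \<circ> f"] by (simp add: sum.reindex[OF True])
next
  case False
  then obtain i j where ij: "i \<in> I" "j \<in> I" "i \<noteq> j" "f i = f j" by (auto simp: inj_on_def)
  define c :: "'i \<Rightarrow> real" where "c k = (if k = i then 1 else if k = j then - 1 else 0)" for k
  have "(\<Sum>k\<in>I. c k *\<^sub>R f k) = (\<Sum>k\<in>{i, j}. c k *\<^sub>R f k)"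
    using ij assms(1) by (intro sum.mono_neutral_right) (auto simp: c_def)
  also have "\<dots> = 0" using ij by (simp add: c_def)
  finally show ?thesis using that[of c] ij(1) by (force simp: c_def)
qed

text \<open>Replacing the coefficients of a vector with vanishing space part by their absolute values does
  not increase the quadratic form, because the mixed products are nonpositive.\<close>
lemma exists_causal_nonneg_combination:
  fixes r :: "'i \<Rightarrow> real \<times> 'a::euclidean_space"
  assumes "finite I" "card I > DIM('a)"
    and nonpos: "pairwise (\<lambda>i j. lorentz (r i) (r j) \<le> 0) I"
  obtains c where "\<forall>i. c i \<ge> 0" "\<exists>i\<in>I. c i > 0"
    "lorentz (\<Sum>i\<in>I. c i *\<^sub>R r i) (\<Sum>i\<in>I. c i *\<^sub>R r i) \<le> 0"
proof -
  obtain c where c: "\<exists>i\<in>I. c i \<noteq> 0" "(\<Sum>i\<in>I. c i *\<^sub>R snd (r i)) = 0"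
    using nontrivial_linear_relation[OF assms(1,2)] .
  have expand: "lorentz (\<Sum>i\<in>I. b i *\<^sub>R r i) (\<Sum>i\<in>I. b i *\<^sub>R r i) =
      (\<Sum>i\<in>I. \<Sum>j\<in>I. b i * b j * lorentz (r i) (r j))" for b
    by (simp only: lorentz.sum_left) (simp add: lorentz.sum_right sum_distrib_left mult_ac)
  have "\<bar>c i\<bar> * \<bar>c j\<bar> * lorentz (r i) (r j) \<le> c i * c j * lorentz (r i) (r j)"
    if "i \<in> I" "j \<in> I" for i j
  proof (cases "i = j")
    case False
    then have "lorentz (r i) (r j) \<le> 0" using nonpos that by (auto simp: pairwise_def)
    then show ?thesis
      using mult_right_mono_neg[OF abs_ge_self[of "c i * c j"]] by (simp add: abs_mult)
  qed simp
  then have "lorentz (\<Sum>i\<in>I. \<bar>c i\<bar> *\<^sub>R r i) (\<Sum>i\<in>I. \<bar>c i\<bar> *\<^sub>R r i) \<le>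
      lorentz (\<Sum>i\<in>I. c i *\<^sub>R r i) (\<Sum>i\<in>I. c i *\<^sub>R r i)"
    unfolding expand by (intro sum_mono)
  also have "\<dots> \<le> 0"
    using c(2) by (simp add: lorentz_self snd_sum)
  finally show ?thesis using that[of "\<lambda>i. \<bar>c i\<bar>"] c(1) by auto
qed

subsection \<open>Directions at infinity\<close>

definition direction :: "real \<times> 'a::real_vector \<Rightarrow> 'a" where
  "direction u = snd u /\<^sub>R fst u"

lemma dist_direction_sq:
  assumes "fst u \<noteq> 0" "fst v \<noteq> 0"
  shows "(dist (direction u) (direction v))\<^sup>2 =
    lorentz u u / (fst u)\<^sup>2 + lorentz v v / (fst v)\<^sup>2 - 2 * lorentz u v / (fst u * fst v)"
proof -
  define w where "w = u /\<^sub>R fst u - v /\<^sub>R fst v"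
  have "(dist (direction u) (direction v))\<^sup>2 = lorentz w w"
    using assms by (simp add: w_def lorentz_self dist_norm direction_def)
  also have "\<dots> =
      lorentz u u / (fst u)\<^sup>2 + lorentz v v / (fst v)\<^sup>2 - 2 * lorentz u v / (fst u * fst v)"
    by (simp add: w_def lorentz_commute[of v u] divide_inverse power2_eq_square algebra_simps)
  finally show ?thesis .
qed

lemma dist_direction_sq_le:
  assumes "fst u > 0" "fst v > 0" "lorentz u u \<le> 1" "lorentz v v \<le> 1" "lorentz u v \<ge> - C"
  shows "(dist (direction u) (direction v))\<^sup>2 \<le>
    (1 / fst u)\<^sup>2 + (1 / fst v)\<^sup>2 + 2 * C * (1 / fst u) * (1 / fst v)"
proof -
  have "lorentz u u / (fst u)\<^sup>2 \<le> 1 / (fst u)\<^sup>2" "lorentz v v / (fst v)\<^sup>2 \<le> 1 / (fst v)\<^sup>2"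
    using assms by (simp_all add: divide_right_mono)
  moreover have "- C / (fst u * fst v) \<le> lorentz u v / (fst u * fst v)"
    using assms by (intro divide_right_mono) auto
  moreover have "(dist (direction u) (direction v))\<^sup>2 =
      lorentz u u / (fst u)\<^sup>2 + lorentz v v / (fst v)\<^sup>2 - 2 * (lorentz u v / (fst u * fst v))"
    using assms by (simp add: dist_direction_sq)
  ultimately have "(dist (direction u) (direction v))\<^sup>2 \<le>
      1 / (fst u)\<^sup>2 + 1 / (fst v)\<^sup>2 - 2 * (- C / (fst u * fst v))"
    by linarith
  then show ?thesis by (simp add: power_one_over)
qed

lemma convergent_direction:
  fixes g :: "nat \<Rightarrow> real \<times> 'a::{real_inner, complete_space}"
  assumes pos: "\<And>k. fst (g k) > 0" and unit: "\<And>k. lorentz (g k) (g k) \<le> 1"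
    and pairs: "\<And>j k. lorentz (g j) (g k) \<ge> -1"
    and height: "filterlim (\<lambda>k. fst (g k)) at_top sequentially"
  shows "convergent (\<lambda>k. direction (g k))"
proof -
  have dist_le: "dist (direction (g j)) (direction (g k)) \<le> 1 / fst (g j) + 1 / fst (g k)" for j k
  proof (rule power2_le_imp_le)
    show "(dist (direction (g j)) (direction (g k)))\<^sup>2 \<le> (1 / fst (g j) + 1 / fst (g k))\<^sup>2"
      using dist_direction_sq_le[OF pos pos unit unit pairs, of j k] by (simp add: power2_sum)
    show "0 \<le> 1 / fst (g j) + 1 / fst (g k)" using pos[of j] pos[of k] by simp
  qed
  have inverse_height: "(\<lambda>k. 1 / fst (g k)) \<longlonglongrightarrow> 0"
    using tendsto_inverse_0_at_top[OF height] by (simp add: inverse_eq_divide)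
  have "Cauchy (\<lambda>k. direction (g k))"
  proof (rule metric_CauchyI)
    fix e :: real assume "e > 0"
    then have "\<forall>\<^sub>F k in sequentially. 1 / fst (g k) < e / 2"
      using order_tendstoD(2)[OF inverse_height, of "e / 2"] by simp
    then obtain M where M: "\<And>k. k \<ge> M \<Longrightarrow> 1 / fst (g k) < e / 2"
      by (auto simp: eventually_sequentially)
    show "\<exists>M. \<forall>m\<ge>M. \<forall>n\<ge>M. dist (direction (g m)) (direction (g n)) < e"
    proof (intro exI allI impI)
      fix m n assume "m \<ge> M" "n \<ge> M"
      then show "dist (direction (g m)) (direction (g n)) < e"
        using dist_le[of m n] M[of m] M[of n] by linarith
    qed
  qed
  then show ?thesis by (rule Cauchy_convergent)
qed

lemma tendsto_direction_transfer:
  assumes g: "\<And>k. fst (g k) > 0" "\<And>k. lorentz (g k) (g k) \<le> 1"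
    and v: "\<And>k. fst (v k) > 0" "\<And>k. lorentz (v k) (v k) \<le> 1"
    and bound: "\<And>k. lorentz (v k) (g k) \<ge> - C"
    and height: "filterlim (\<lambda>k. fst (g k)) at_top F" "filterlim (\<lambda>k. fst (v k)) at_top F"
    and lim: "((\<lambda>k. direction (g k)) \<longlongrightarrow> l) F"
  shows "((\<lambda>k. direction (v k)) \<longlongrightarrow> l) F"
proof -
  let ?bound = "\<lambda>k. (1 / fst (v k))\<^sup>2 + (1 / fst (g k))\<^sup>2 +
      2 * C * (1 / fst (v k)) * (1 / fst (g k))"
  have inverse_height: "((\<lambda>k. 1 / fst (g k)) \<longlongrightarrow> 0) F" "((\<lambda>k. 1 / fst (v k)) \<longlongrightarrow> 0) F"
    using height[THEN tendsto_inverse_0_at_top] by (simp_all add: inverse_eq_divide)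
  have "(?bound \<longlongrightarrow> 0\<^sup>2 + 0\<^sup>2 + 2 * C * 0 * 0) F"
    by (intro tendsto_intros inverse_height)
  then have bound_tendsto: "(?bound \<longlongrightarrow> 0) F" by simp
  have "((\<lambda>k. (dist (direction (v k)) (direction (g k)))\<^sup>2) \<longlongrightarrow> 0) F"
    by (rule tendsto_sandwich[OF _ _ tendsto_const bound_tendsto])
      (use dist_direction_sq_le[OF v(1) g(1) v(2) g(2) bound]
        in \<open>simp_all only: zero_le_power2 always_eventually simp_thms\<close>)
  then have "((\<lambda>k. dist (direction (v k)) (direction (g k))) \<longlongrightarrow> 0) F"
    using tendsto_real_sqrt[of "\<lambda>k. (dist (direction (v k)) (direction (g k)))\<^sup>2" 0] by simp
  then have "((\<lambda>k. (direction (v k) - direction (g k)) + direction (g k)) \<longlongrightarrow> 0 + l) F"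
    by (intro tendsto_add lim) (simp add: tendsto_norm_zero_iff dist_norm)
  then show ?thesis by simp
qed

section \<open>Words in reflections\<close>

primrec word_act :: "('i \<Rightarrow> real \<times> 'a::real_inner) \<Rightarrow> 'i list \<Rightarrow> real \<times> 'a \<Rightarrow> real \<times> 'a" where
  "word_act r [] v = v"
| "word_act r (i # w) v = reflect (r i) (word_act r w v)"

lemma word_act_append [simp]: "word_act r (w @ w') v = word_act r w (word_act r w' v)"
  by (induction w) auto

lemma word_act_append_cong:
  "word_act r w1 = word_act r w2 \<Longrightarrow> word_act r w1' = word_act r w2' \<Longrightarrow>
    word_act r (w1 @ w1') = word_act r (w2 @ w2')"
  by auto

lemma linear_word_act: "linear (word_act r w)"
proof (induction w)
  case Nil
  show ?case by (simp add: linear_iff)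
next
  case (Cons i w)
  show ?case using linear_compose[OF Cons linear_reflect[of "r i"]] by (simp add: o_def linear_iff)
qed

lemmas word_act_add = linear_add[OF linear_word_act]
  and word_act_diff = linear_diff[OF linear_word_act]
  and word_act_scale = linear_scale[OF linear_word_act]
  and word_act_neg = linear_neg[OF linear_word_act]

lemma word_act_eq_self:
  "(\<And>i. i \<in> set w \<Longrightarrow> lorentz v (r i) = 0) \<Longrightarrow> word_act r w v = v"
  by (induction w) (auto simp: reflect_def)

locale unit_roots =
  fixes r :: "'i \<Rightarrow> real \<times> 'a::real_inner" and I :: "'i set"
  assumes unit: "i \<in> I \<Longrightarrow> lorentz (r i) (r i) = 1"
begin

lemma word_act_rev [simp]: "set w \<subseteq> I \<Longrightarrow> word_act r (rev w) (word_act r w v) = v"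
  by (induction w arbitrary: v) (auto simp: unit)

lemma word_act_word_act_rev [simp]: "set w \<subseteq> I \<Longrightarrow> word_act r w (word_act r (rev w) v) = v"
  using word_act_rev[of "rev w"] by simp

lemma word_act_rev_cong:
  assumes "set w \<subseteq> I" "set w' \<subseteq> I" "word_act r w = word_act r w'"
  shows "word_act r (rev w) = word_act r (rev w')"
proof
  fix v
  have "word_act r (rev w) v = word_act r (rev w) (word_act r w' (word_act r (rev w') v))"
    using assms(2) by simp
  also have "\<dots> = word_act r (rev w') v"
    using assms(1) by (simp flip: assms(3))
  finally show "word_act r (rev w) v = word_act r (rev w') v" .
qed

lemma word_act_cancel: "i \<in> I \<Longrightarrow> word_act r (w @ i # i # w') = word_act r (w @ w')"
  by (auto simp: unit)

lemma lorentz_word_act: "set w \<subseteq> I \<Longrightarrow> lorentz (word_act r w u) (word_act r w v) = lorentz u v"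
  by (induction w) (auto simp: lorentz_reflect unit)

lemma lorentz_word_act_left:
  "set w \<subseteq> I \<Longrightarrow> lorentz (word_act r w u) v = lorentz u (word_act r (rev w) v)"
  using lorentz_word_act[of w u "word_act r (rev w) v"] by simp

lemma word_act_conjugate:
  assumes "set w \<subseteq> I"
  shows "word_act r (w @ i # rev w) v = reflect (word_act r w (r i)) v"
  using lorentz_word_act_left[of "rev w" v "r i"] assms
  by (simp add: reflect_def word_act_diff word_act_scale)

lemma word_act_mem_hyperboloid:
  "set w \<subseteq> I \<Longrightarrow> v \<in> hyperboloid \<Longrightarrow> word_act r w v \<in> hyperboloid"
  by (induction w) (auto intro: reflect_mem_hyperboloid unit)

definition word_length :: "'i list \<Rightarrow> nat" where
  "word_length w = (LEAST n. \<exists>w'. set w' \<subseteq> I \<and> length w' = n \<and> word_act r w' = word_act r w)"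

definition reduced :: "'i list \<Rightarrow> bool" where
  "reduced w \<longleftrightarrow> word_length w = length w"

lemma word_length_le: "set w' \<subseteq> I \<Longrightarrow> word_act r w' = word_act r w \<Longrightarrow> word_length w \<le> length w'"
  unfolding word_length_def by (rule Least_le) blast

lemma word_length_le_length: "set w \<subseteq> I \<Longrightarrow> word_length w \<le> length w"
  by (rule word_length_le) auto

lemma word_length_cong: "word_act r w = word_act r w' \<Longrightarrow> word_length w = word_length w'"
  unfolding word_length_def by simp

lemma exists_reduced_word:
  assumes "set w \<subseteq> I"
  obtains w' where "set w' \<subseteq> I" "word_act r w' = word_act r w" "length w' = word_length w"
proof -
  have "\<exists>w'. set w' \<subseteq> I \<and> length w' = word_length w \<and> word_act r w' = word_act r w"
    unfolding word_length_def by (rule LeastI[of _ "length w"]) (use assms in blast)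
  then show ?thesis using that by blast
qed

lemma word_length_append_le:
  assumes "set w \<subseteq> I" "set w' \<subseteq> I"
  shows "word_length (w @ w') \<le> word_length w + word_length w'"
proof -
  obtain v v' where v: "set v \<subseteq> I" "word_act r v = word_act r w" "length v = word_length w"
    and v': "set v' \<subseteq> I" "word_act r v' = word_act r w'" "length v' = word_length w'"
    using exists_reduced_word assms by metis
  show ?thesis
    using word_length_le[of "v @ v'" "w @ w'"] word_act_append_cong[OF v(2) v'(2)] v v' by simp
qed

lemma word_length_append_le_length:
  assumes "set w \<subseteq> I" "set w' \<subseteq> I"
  shows "word_length (w @ w') \<le> word_length w + length w'"
  using word_length_append_le[OF assms] word_length_le_length[OF assms(2)] by linarith

lemma word_length_snoc_snoc: "i \<in> I \<Longrightarrow> word_length ((w @ [i]) @ [i]) = word_length w"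
  using word_act_cancel[of i w "[]"] by (intro word_length_cong) simp

lemma word_length_le_Suc_snoc:
  assumes "set w \<subseteq> I" "i \<in> I"
  shows "word_length w \<le> Suc (word_length (w @ [i]))"
  using word_length_append_le_length[of "w @ [i]" "[i]"] word_length_snoc_snoc[OF assms(2), of w]
    assms by simp

lemma word_length_rev:
  assumes "set w \<subseteq> I"
  shows "word_length (rev w) = word_length w"
proof -
  have "word_length (rev w) \<le> word_length w" if w: "set w \<subseteq> I" for w
  proof -
    obtain v where v: "set v \<subseteq> I" "word_act r v = word_act r w" "length v = word_length w"
      using exists_reduced_word[OF w] .
    then show ?thesis
      using word_length_le[of "rev v" "rev w"] word_act_rev_cong[OF v(1) w v(2)] by simp
  qed
  from this[OF assms] this[of "rev w"] show ?thesis using assms by simp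
qed

lemma exists_descent:
  assumes "set w \<subseteq> I" "word_act r w \<noteq> word_act r []"
  obtains t where "t \<in> I" "word_length (w @ [t]) < word_length w"
proof -
  obtain w' where w': "set w' \<subseteq> I" "word_act r w' = word_act r w" "length w' = word_length w"
    using exists_reduced_word[OF assms(1)] .
  moreover have "w' \<noteq> []" using w'(2) assms(2) by auto
  ultimately obtain v t where vt: "w' = v @ [t]" "t \<in> I" "set v \<subseteq> I"
    by (cases w' rule: rev_cases) auto
  have "word_length (w @ [t]) = word_length ((v @ [t]) @ [t])"
    using w'(2) vt(1) by (intro word_length_cong word_act_append_cong) simp_all
  also have "\<dots> \<le> length v"
    using vt by (simp only: word_length_snoc_snoc word_length_le_length)
  finally show ?thesis using that w'(3) vt by simp
qed

lemma reduced_appendD1: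
  assumes "set (w @ w') \<subseteq> I" "reduced (w @ w')"
  shows "reduced w"
  using word_length_append_le_length[of w w'] word_length_le_length[of w] assms
  by (simp add: reduced_def)

lemma reduced_rev: "set w \<subseteq> I \<Longrightarrow> reduced (rev w) \<longleftrightarrow> reduced w"
  by (simp add: reduced_def word_length_rev)

lemma reduced_appendD2:
  assumes "set (w @ w') \<subseteq> I" "reduced (w @ w')"
  shows "reduced w'"
  using reduced_appendD1[of "rev w'" "rev w"] reduced_rev[of "w @ w'"] reduced_rev[of w']
    assms by simp

lemma word_length_add_two_le_if_not_distinct_adj:
  assumes "set w \<subseteq> I" "\<not> distinct_adj w"
  shows "word_length w + 2 \<le> length w"
proof -
  obtain k where k: "Suc k < length w" "w ! k = w ! Suc k"
    using assms(2) by (auto simp: distinct_adj_conv_nth)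
  define u u' where "u = take k w" and "u' = drop (Suc (Suc k)) w"
  have w: "w = u @ w ! k # w ! k # u'"
    using id_take_nth_drop[of k w] Cons_nth_drop_Suc[of "Suc k" w] k by (simp add: u_def u'_def)
  then have "set w = insert (w ! k) (set (u @ u'))"
    by (metis list.simps(15) set_append insert_absorb2 Un_insert_right)
  then have "w ! k \<in> I" and "set (u @ u') \<subseteq> I" using assms(1) by simp_all
  moreover have "word_act r (u @ u') = word_act r w"
    using word_act_cancel[OF \<open>w ! k \<in> I\<close>, of u u'] w by simp
  ultimately have "word_length w \<le> length (u @ u')" by (intro word_length_le)
  moreover have "length w = length (u @ u') + 2"
    by (subst w) simp
  ultimately show ?thesis by simp
qed

lemma parabolic_factorization:
  assumes "set w \<subseteq> I" "J \<subseteq> I"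
  obtains v x where "set v \<subseteq> I" "set x \<subseteq> J" "word_act r (v @ x) = word_act r w"
    "word_length v + length x = word_length w" "\<And>j. j \<in> J \<Longrightarrow> word_length (v @ [j]) \<ge> word_length v"
proof -
  have "\<exists>v x. set v \<subseteq> I \<and> set x \<subseteq> J \<and> word_act r (v @ x) = word_act r w \<and>
      word_length v + length x = word_length w \<and> (\<forall>j\<in>J. word_length (v @ [j]) \<ge> word_length v)"
    using assms(1)
  proof (induction "word_length w" arbitrary: w rule: less_induct)
    case less
    show ?case
    proof (cases "\<exists>j\<in>J. word_length (w @ [j]) < word_length w")
      case True
      then obtain j where j: "j \<in> J" "j \<in> I" "word_length (w @ [j]) < word_length w"
        using assms(2) by blast
      then obtain v x where v: "set v \<subseteq> I" "\<forall>j\<in>J. word_length (v @ [j]) \<ge> word_length v"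
        and x: "set x \<subseteq> J" "word_act r (v @ x) = word_act r (w @ [j])"
        and sum: "word_length v + length x = word_length (w @ [j])"
        using less.hyps[of "w @ [j]"] less.prems by auto
      have "word_act r (v @ x @ [j]) = word_act r w"
        using word_act_append_cong[OF x(2) refl, of "[j]"] word_act_cancel[OF j(2), of w "[]"]
        by simp
      moreover have "word_length v + length (x @ [j]) = word_length w"
        using sum j word_length_le_Suc_snoc[OF less.prems j(2)] by simp
      moreover have "set (x @ [j]) \<subseteq> J" using x(1) j(1) by simp
      ultimately show ?thesis using v by blast
    next
      case False
      then have "\<forall>j\<in>J. word_length (w @ [j]) \<ge> word_length w" by (simp add: not_less)
      moreover have "word_act r (w @ []) = word_act r w" "word_length w + length [] = word_length w"
        by simp_all
      ultimately show ?thesis using less.prems by (intro exI[of _ w] exI[of _ "[]"]) auto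
    qed
  qed
  then show ?thesis using that by blast
qed

lemma dihedral_factorization:
  assumes w: "set w \<subseteq> I" and I: "i \<in> I" "t \<in> I"
    and ascent: "word_length w \<le> word_length (w @ [i])"
    and descent: "word_length (w @ [t]) < word_length w"
  obtains v x where "set v \<subseteq> I" "set x \<subseteq> {i, t}" "word_act r (v @ x) = word_act r w"
    "word_length v < word_length w" "word_length v \<le> word_length (v @ [i])"
    "word_length v \<le> word_length (v @ [t])" "length x \<le> word_length (x @ [i])"
proof -
  have "{i, t} \<subseteq> I" using I by simp
  then obtain v x where v: "set v \<subseteq> I" and x: "set x \<subseteq> {i, t}"
    and vx: "word_act r (v @ x) = word_act r w"
    and sum: "word_length v + length x = word_length w"
    and minimal: "\<And>j. j \<in> {i, t} \<Longrightarrow> word_length v \<le> word_length (v @ [j])"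
    using parabolic_factorization[OF w] by blast
  have "x \<noteq> []"
  proof
    assume "x = []"
    then have "word_act r v = word_act r w" using vx by simp
    then have "word_length v = word_length w" "word_length (v @ [t]) = word_length (w @ [t])"
      by (auto intro!: word_length_cong word_act_append_cong)
    then show False using minimal[of t] descent by simp
  qed
  then have "word_length v < word_length w" using sum by (cases x) simp_all
  moreover have "length x \<le> word_length (x @ [i])"
  proof -
    have "word_length (w @ [i]) = word_length (v @ x @ [i])"
      using word_act_append_cong[OF vx refl, of "[i]"] by (intro word_length_cong) simp
    also have "\<dots> \<le> word_length v + word_length (x @ [i])"
      using v x I by (intro word_length_append_le) auto
    finally show ?thesis using sum ascent by linarith
  qed
  ultimately show ?thesis using that v x vx minimal by blast
qed

end

subsection \<open>Dihedral words\<close>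

text \<open>Letters are added in front, so that the last letter is always \<open>t\<close>.\<close>
primrec alternating :: "'i \<Rightarrow> 'i \<Rightarrow> nat \<Rightarrow> 'i list" where
  "alternating i t 0 = []"
| "alternating i t (Suc k) = (if even k then t else i) # alternating i t k"

lemma length_alternating [simp]: "length (alternating i t k) = k"
  by (induction k) auto

lemma set_alternating: "set (alternating i t k) \<subseteq> {i, t}"
  by (induction k) auto

lemma alternating_Suc_snoc: "alternating i t (Suc k) = alternating t i k @ [t]"
  by (induction k) auto

lemma alternating_add:
  "\<exists>y. length y = j \<and> set y \<subseteq> {i, t} \<and> alternating i t (j + k) = y @ alternating i t k"
proof (induction j)
  case (Suc j)
  then obtain y where "length y = j" "set y \<subseteq> {i, t}"
    "alternating i t (j + k) = y @ alternating i t k"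
    by blast
  then show ?case by (intro exI[of _ "(if even (j + k) then t else i) # y"]) auto
qed simp

lemma distinct_adj_eq_alternating:
  assumes "distinct_adj (x @ [i])" "set x \<subseteq> {i, t}"
  shows "x = alternating i t (length x)"
  using assms
proof (induction x)
  case (Cons a x)
  then have x: "x = alternating i t (length x)" by (auto dest: distinct_adj_ConsD)
  have "hd (alternating i t k @ [i]) = (if even k then i else t)" for k
    by (cases k) auto
  then have "hd (x @ [i]) = (if even (length x) then i else t)" by (metis x)
  then have "a = (if even (length x) then t else i)"
    using Cons.prems by (auto simp: distinct_adj_Cons split: if_splits)
  then show ?case using x by simp
qed simp

text \<open>The Chebyshev polynomials of the second kind, with the index shifted by one.\<close>
fun chebyshev :: "real \<Rightarrow> nat \<Rightarrow> real" where
  "chebyshev c 0 = 0"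
| "chebyshev c (Suc 0) = 1"
| "chebyshev c (Suc (Suc k)) = 2 * c * chebyshev c (Suc k) - chebyshev c k"

lemma chebyshev_less_Suc:
  assumes "c \<ge> 1"
  shows "0 \<le> chebyshev c k \<and> chebyshev c k < chebyshev c (Suc k)"
proof (induction k)
  case (Suc k)
  then have "chebyshev c (Suc k) \<le> c * chebyshev c (Suc k)"
    using mult_right_mono[OF assms, of "chebyshev c (Suc k)"] by simp
  then show ?case using Suc unfolding chebyshev.simps mult.assoc by linarith
qed simp

lemma sin_mult_chebyshev: "sin \<theta> * chebyshev (cos \<theta>) k = sin (real k * \<theta>)"
proof (induction "cos \<theta>" k rule: chebyshev.induct)
  case (3 k)
  have "sin (real (Suc (Suc k)) * \<theta>) + sin (real k * \<theta>) = 2 * cos \<theta> * sin (real (Suc k) * \<theta>)"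
    using sin_add[of "real (Suc k) * \<theta>" \<theta>] sin_diff[of "real (Suc k) * \<theta>" \<theta>]
    by (simp add: algebra_simps)
  then show ?case using 3 by (simp add: algebra_simps)
qed simp_all

lemma sin_pi_div_pos: "m \<ge> 2 \<Longrightarrow> sin (pi / real m) > 0" for m :: nat
  by (rule sin_gt_zero) (auto simp: field_simps)

lemma chebyshev_cos_pi_div:
  assumes "m \<ge> 2"
  shows "chebyshev (cos (pi / real m)) k = sin (real k * (pi / real m)) / sin (pi / real m)"
  using sin_mult_chebyshev[of "pi / real m" k] sin_pi_div_pos[OF assms] by (simp add: field_simps)

lemma chebyshev_cos_pi_div_pos:
  assumes "0 < k" "k < m"
  shows "chebyshev (cos (pi / real m)) k > 0"
proof (cases "m \<ge> 2")
  case True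
  have "0 < sin (real k * (pi / real m))"
    using assms by (intro sin_gt_zero) (auto simp: field_simps)
  then show ?thesis using sin_pi_div_pos[OF True] by (simp add: chebyshev_cos_pi_div[OF True])
qed (use assms in simp)

lemma chebyshev_cos_pi_div_self:
  assumes "m \<ge> 2"
  shows "chebyshev (cos (pi / real m)) m = 0" "chebyshev (cos (pi / real m)) (Suc m) = -1"
proof -
  have "real m * (pi / real m) = pi" "real (Suc m) * (pi / real m) = pi / real m + pi"
    using assms by (simp_all add: field_simps)
  then show "chebyshev (cos (pi / real m)) m = 0" "chebyshev (cos (pi / real m)) (Suc m) = -1"
    using sin_pi_div_pos[OF assms] by (simp_all only: chebyshev_cos_pi_div[OF assms]) simp_all
qed

text \<open>The possible products of two outward unit normals: disjoint walls, or walls bounding an angle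
  \<open>\<pi> / m\<close>.\<close>
definition coxeter_product :: "real \<Rightarrow> bool" where
  "coxeter_product g \<longleftrightarrow> g \<le> -1 \<or> (\<exists>m::nat. m \<ge> 2 \<and> g = - cos (pi / real m))"

lemma coxeter_product_nonpos:
  assumes "coxeter_product g"
  shows "g \<le> 0"
proof -
  have "cos (pi / real m) \<ge> 0" if "m \<ge> 2" for m :: nat
  proof (rule cos_ge_zero)
    show "pi / real m \<le> pi / 2" using that by (intro divide_left_mono) auto
    show "- (pi / 2) \<le> pi / real m" by (rule order_trans[of _ 0]) auto
  qed
  then show ?thesis using assms by (auto simp: coxeter_product_def)
qed

context unit_roots
begin

lemma word_act_alternating:
  assumes "i \<in> I" "t \<in> I"
  defines "c \<equiv> - lorentz (r i) (r t)"
  shows "word_act r (alternating i t k) (r i) =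
    chebyshev c (Suc k) *\<^sub>R r (if even k then i else t) +
    chebyshev c k *\<^sub>R r (if even k then t else i)"
proof (induction k)
  case (Suc k)
  have reflect_combination: "reflect a (x *\<^sub>R b + y *\<^sub>R a) = (2 * c * x - y) *\<^sub>R a + x *\<^sub>R b"
    if "lorentz a a = 1" "lorentz b a = - c" for a b :: "real \<times> 'a" and x y
    using that by (simp add: reflect_def algebra_simps flip: scaleR_2)
  have "lorentz (r i) (r t) = - c" "lorentz (r t) (r i) = - c"
    by (simp_all add: c_def lorentz_commute)
  then show ?case
    using assms(1,2) Suc by (simp add: reflect_combination unit)
qed simp

lemma word_act_alternating_pi:
  assumes "i \<in> I" "t \<in> I" "m \<ge> 2" "lorentz (r i) (r t) = - cos (pi / real m)"
  shows "word_act r (alternating i t m) (r i) = - r (if even m then i else t)"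
    and "word_act r (alternating t i m) (r i) = - r (if even m then i else t)"
proof -
  note image = word_act_alternating[OF assms(1,2), unfolded assms(4) minus_minus]
  show "word_act r (alternating i t m) (r i) = - r (if even m then i else t)"
    using chebyshev_cos_pi_div_self[OF assms(3)] by (simp add: image del: chebyshev.simps)
  obtain k where k: "m = Suc k" using assms(3) by (cases m) auto
  have "chebyshev (cos (pi / real m)) k = 1"
    using chebyshev_cos_pi_div_self[OF assms(3)] by (simp add: k)
  then have "word_act r (alternating i t k) (r i) = r (if even m then i else t)"
    using image[of k] chebyshev_cos_pi_div_self(1)[OF assms(3)] by (simp add: k)
  then show "word_act r (alternating t i m) (r i) = - r (if even m then i else t)"
    unfolding k alternating_Suc_snoc using assms(1) by (simp add: reflect_self unit word_act_neg)
qed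

lemma braid_relation:
  assumes "i \<in> I" "t \<in> I" "m \<ge> 2" "lorentz (r i) (r t) = - cos (pi / real m)"
  shows "word_act r (alternating i t m) = word_act r (alternating t i m)"
proof
  fix v
  have "(lorentz (r i) (r t))\<^sup>2 \<noteq> 1"
    using sin_pi_div_pos[OF assms(3)] sin_squared_eq[of "pi / real m"] by (auto simp: assms(4))
  then obtain p x y where v: "v = p + x *\<^sub>R r i + y *\<^sub>R r t"
      "lorentz p (r i) = 0" "lorentz p (r t) = 0"
    using orthogonal_decomposition[of "r i" "r t" v] assms(1,2) unit by metis
  have "word_act r (alternating i t m) p = p" "word_act r (alternating t i m) p = p"
    using set_alternating[of i t m] set_alternating[of t i m] v by (auto intro!: word_act_eq_self)
  moreover have "lorentz (r t) (r i) = - cos (pi / real m)"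
    using assms(4) by (simp add: lorentz_commute)
  note word_act_alternating_pi[OF assms] word_act_alternating_pi[OF assms(2,1,3) this]
  ultimately show "word_act r (alternating i t m) v = word_act r (alternating t i m) v"
    by (simp add: v(1) word_act_add word_act_scale)
qed

lemma length_less_order_if_ascent:
  assumes I: "i \<in> I" "t \<in> I" and m: "m \<ge> 2" "lorentz (r i) (r t) = - cos (pi / real m)"
    and ascent: "k \<le> word_length (alternating i t k @ [i])"
  shows "k < m"
proof (rule ccontr)
  assume "\<not> k < m"
  then have "k = (k - m) + m" by simp
  then obtain y where y: "length y = k - m" "set y \<subseteq> {i, t}"
      "alternating i t k = y @ alternating i t m"
    using alternating_add[of "k - m" i t m] by auto
  define x where "x = y @ alternating i t (m - 1)"
  have "alternating t i m = alternating i t (m - 1) @ [i]"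
    using alternating_Suc_snoc[of t i "m - 1"] m(1) by simp
  then have "word_act r (y @ alternating t i m) = word_act r (x @ [i])" by (simp add: x_def)
  moreover have "word_act r (alternating i t k) = word_act r (y @ alternating t i m)"
    unfolding y(3) by (rule word_act_append_cong[OF refl braid_relation[OF I m]])
  ultimately have "word_act r (alternating i t k @ [i]) = word_act r ((x @ [i]) @ [i])"
    by (intro word_act_append_cong) simp_all
  then have "word_length (alternating i t k @ [i]) = word_length x"
    using word_length_cong word_length_snoc_snoc[OF I(1)] by metis
  also have "\<dots> \<le> length x"
    using y(2) I set_alternating[of i t "m - 1"] by (intro word_length_le_length) (auto simp: x_def)
  also have "\<dots> < k" using y(1) m(1) \<open>\<not> k < m\<close> by (simp add: x_def)
  finally show False using ascent by simp
qed

lemma dihedral_ascent_root_nonneg: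
  assumes I: "i \<in> I" "t \<in> I" and product: "coxeter_product (lorentz (r i) (r t))"
    and x: "set x \<subseteq> {i, t}" and ascent: "length x \<le> word_length (x @ [i])"
  obtains a b where "word_act r x (r i) = a *\<^sub>R r i + b *\<^sub>R r t" "a \<ge> 0" "b \<ge> 0" "a + b > 0"
proof -
  define k where "k = length x"
  define c where "c = - lorentz (r i) (r t)"
  have "distinct_adj (x @ [i])"
    using word_length_add_two_le_if_not_distinct_adj[of "x @ [i]"] ascent x I by fastforce
  then have alternating: "x = alternating i t k"
    unfolding k_def using x by (rule distinct_adj_eq_alternating)
  have "chebyshev c (Suc k) \<ge> 0 \<and> chebyshev c k \<ge> 0 \<and> chebyshev c (Suc k) + chebyshev c k > 0"
  proof (cases "c \<ge> 1")
    case True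
    then show ?thesis using chebyshev_less_Suc[of c k] by linarith
  next
    case False
    then obtain m :: nat where m: "m \<ge> 2" "lorentz (r i) (r t) = - cos (pi / real m)"
      using product by (auto simp: coxeter_product_def c_def)
    have "k < m"
      using length_less_order_if_ascent[OF I m, of k] ascent by (simp flip: alternating k_def)
    then have "chebyshev c (Suc k) \<ge> 0"
      using chebyshev_cos_pi_div_pos[of "Suc k" m] chebyshev_cos_pi_div_self(1)[OF m(1)]
      by (cases "Suc k = m") (simp_all add: c_def m(2))
    moreover have "chebyshev c k > 0 \<or> k = 0"
      using chebyshev_cos_pi_div_pos[of k m] \<open>k < m\<close> by (auto simp: c_def m(2))
    ultimately show ?thesis by (auto simp: less_imp_le add_nonneg_pos)
  qed
  moreover have "word_act r x (r i) =
      chebyshev c (Suc k) *\<^sub>R r (if even k then i else t) +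
      chebyshev c k *\<^sub>R r (if even k then t else i)"
    unfolding alternating c_def by (rule word_act_alternating[OF I])
  ultimately show ?thesis
    using that[of "chebyshev c (Suc k)" "chebyshev c k"]
      that[of "chebyshev c k" "chebyshev c (Suc k)"]
    by (cases "even k") (simp_all add: add.commute)
qed

end

section \<open>Hyperbolic reflection groups\<close>

locale reflection_chamber = unit_roots r I
  for r :: "'i \<Rightarrow> real \<times> 'a::euclidean_space" and I :: "'i set" +
  assumes finite_index: "finite I"
    and outward: "i \<in> I \<Longrightarrow> fst (r i) > 0"
    and coxeter: "i \<in> I \<Longrightarrow> j \<in> I \<Longrightarrow> i \<noteq> j \<Longrightarrow> coxeter_product (lorentz (r i) (r j))"
begin

lemma ascent_imp_root_pos:
  assumes "set w \<subseteq> I" "i \<in> I" "word_length w \<le> word_length (w @ [i])"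
  shows "fst (word_act r w (r i)) > 0"
  using assms
proof (induction "word_length w" arbitrary: w i rule: less_induct)
  case (less w i)
  show ?case
  proof (cases "\<exists>t\<in>I. word_length (w @ [t]) < word_length w")
    case False
    then have "word_act r w = word_act r []" using exists_descent[OF less.prems(1)] by blast
    then show ?thesis using outward[OF less.prems(2)] by simp
  next
    case True
    then obtain t where t: "t \<in> I" "word_length (w @ [t]) < word_length w" by blast
    then have "i \<noteq> t" using less.prems(3) by auto
    obtain v x where v: "set v \<subseteq> I" and x: "set x \<subseteq> {i, t}" "length x \<le> word_length (x @ [i])"
      and vx: "word_act r (v @ x) = word_act r w" and shorter: "word_length v < word_length w"
      and ascent: "word_length v \<le> word_length (v @ [i])" "word_length v \<le> word_length (v @ [t])"
      using dihedral_factorization[OF less.prems(1,2) t(1) less.prems(3) t(2)] .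
    have pos: "fst (word_act r v (r i)) > 0" "fst (word_act r v (r t)) > 0"
      using less.hyps[OF shorter v] less.prems(2) t(1) ascent by auto
    obtain a b where ab: "word_act r x (r i) = a *\<^sub>R r i + b *\<^sub>R r t" "a \<ge> 0" "b \<ge> 0" "a + b > 0"
      using dihedral_ascent_root_nonneg[OF less.prems(2) t(1) coxeter x]
        less.prems(2) t(1) \<open>i \<noteq> t\<close> .
    have "word_act r w (r i) = word_act r v (word_act r x (r i))"
      by (simp flip: vx)
    then have "fst (word_act r w (r i)) =
        a * fst (word_act r v (r i)) + b * fst (word_act r v (r t))"
      by (simp add: ab(1) word_act_add word_act_scale)
    also have "\<dots> > 0"
      using pos ab by (cases "a = 0") (auto intro: add_pos_nonneg)
    finally show ?thesis .
  qed
qed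

lemma descent_imp_root_neg:
  assumes "set w \<subseteq> I" "i \<in> I" "word_length (w @ [i]) \<le> word_length w"
  shows "fst (word_act r w (r i)) < 0"
proof -
  have "fst (word_act r (w @ [i]) (r i)) > 0"
    using assms by (intro ascent_imp_root_pos)
      (simp_all only: word_length_snoc_snoc set_append, simp_all)
  then show ?thesis using assms(2) by (simp add: reflect_self unit word_act_neg)
qed

lemma exists_ascent:
  assumes "card I > DIM('a)" and w: "set w \<subseteq> I"
  shows "\<exists>i\<in>I. word_length (w @ [i]) > word_length w"
proof (rule ccontr)
  assume "\<not> ?thesis"
  then have neg: "fst (word_act r w (r i)) < 0" if "i \<in> I" for i
    using descent_imp_root_neg[OF w that] that by (simp add: not_less)
  have "pairwise (\<lambda>i j. lorentz (r i) (r j) \<le> 0) I"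
    using coxeter_product_nonpos coxeter by (auto simp: pairwise_def)
  then obtain c where c: "\<forall>i. c i \<ge> 0" "\<exists>i\<in>I. c i > 0"
    and causal: "lorentz (\<Sum>i\<in>I. c i *\<^sub>R r i) (\<Sum>i\<in>I. c i *\<^sub>R r i) \<le> 0"
    using exists_causal_nonneg_combination[OF finite_index assms(1)] by blast
  define d where "d = (\<Sum>i\<in>I. c i *\<^sub>R r i)"
  have sum_pos: "(\<Sum>i\<in>I. c i * f i) > 0" if "\<And>i. i \<in> I \<Longrightarrow> f i > 0" for f :: "'i \<Rightarrow> real"
    using c that by (auto intro!: sum_pos2[OF finite_index] simp: less_imp_le)
  have "lorentz d (1, 0) < 0"
    using sum_pos[of "\<lambda>i. fst (r i)"] outward by (simp add: d_def fst_sum)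
  moreover have "word_act r (rev w) (1, 0) \<in> hyperboloid"
    using w by (intro word_act_mem_hyperboloid) simp_all
  ultimately have "lorentz d (word_act r (rev w) (1, 0)) < 0"
    using lorentz_causal_constant_sign causal base_mem_hyperboloid unfolding d_def by blast
  moreover have "lorentz d (word_act r (rev w) (1, 0)) = - fst (word_act r w d)"
    using lorentz_word_act_left[OF w, of d "(1, 0)"] by simp
  moreover have "fst (word_act r w d) = (\<Sum>i\<in>I. c i * fst (word_act r w (r i)))"
    by (simp add: d_def linear_sum[OF linear_word_act] word_act_scale fst_sum)
  moreover have "\<dots> < 0"
    using sum_pos[of "\<lambda>i. - fst (word_act r w (r i))"] neg by (simp add: sum_negf)
  ultimately show False by simp
qed

subsection \<open>Discreteness of the orbit\<close>

definition orbit :: "(real \<times> 'a) set" where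
  "orbit = {word_act r w (1, 0) | w. set w \<subseteq> I}"

definition roots :: "(real \<times> 'a) set" where
  "roots = {word_act r w (r i) | w i. set w \<subseteq> I \<and> i \<in> I}"

lemma orbit_subset_hyperboloid: "orbit \<subseteq> hyperboloid"
  unfolding orbit_def using word_act_mem_hyperboloid[OF _ base_mem_hyperboloid] by blast

lemma lorentz_root_self: "g \<in> roots \<Longrightarrow> lorentz g g = 1"
  by (auto simp: roots_def lorentz_word_act unit)

lemma reflect_root_base_mem_orbit:
  assumes "g \<in> roots"
  shows "reflect g (1, 0) \<in> orbit"
proof -
  obtain w i where w: "g = word_act r w (r i)" "set w \<subseteq> I" "i \<in> I"
    using assms by (auto simp: roots_def)
  then have "reflect g (1, 0) = word_act r (w @ i # rev w) (1, 0)" "set (w @ i # rev w) \<subseteq> I"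
    by (simp_all only: word_act_conjugate) auto
  then show ?thesis unfolding orbit_def by blast
qed

lemma orbit_point_beyond_wall:
  assumes "y \<in> orbit" "y \<noteq> (1, 0)"
  obtains i where "i \<in> I" "lorentz (r i) y > 0"
proof -
  obtain w where w: "set w \<subseteq> I" "y = word_act r w (1, 0)"
    using assms(1) by (auto simp: orbit_def)
  have "word_act r (rev w) \<noteq> word_act r []"
    using assms(2) w word_act_rev_cong[of "rev w" "[]"] by auto
  then obtain i where i: "i \<in> I" "word_length (rev w @ [i]) < word_length (rev w)"
    using exists_descent[of "rev w"] w(1) by auto
  then have "fst (word_act r (rev w) (r i)) < 0"
    using w(1) by (intro descent_imp_root_neg) auto
  then have "lorentz (r i) y > 0"
    using lorentz_word_act_left[of "rev w" "r i" "(1, 0)"] w by simp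
  then show ?thesis using that i(1) by blast
qed

lemma orbit_height_gap:
  obtains h where "h > 1" "\<And>y. y \<in> orbit \<Longrightarrow> y \<noteq> (1, 0) \<Longrightarrow> fst y \<ge> h"
proof
  define c where "c = Min (insert 1 ((\<lambda>i. (fst (r i))\<^sup>2) ` I))"
  have "c > 0" using finite_index outward by (auto simp: c_def dest: less_imp_neq[OF outward])
  then show "sqrt (1 + c) > 1" by simp
  show "fst y \<ge> sqrt (1 + c)" if y: "y \<in> orbit" "y \<noteq> (1, 0)" for y
  proof -
    have hyp: "y \<in> hyperboloid" using y(1) orbit_subset_hyperboloid by blast
    obtain i where i: "i \<in> I" "lorentz (r i) y > 0" using orbit_point_beyond_wall[OF y] .
    then have "(fst y)\<^sup>2 > 1 + (fst (r i))\<^sup>2"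
      using hyp by (intro fst_sq_gt_if_beyond_wall unit outward)
    moreover have "c \<le> (fst (r i))\<^sup>2" using i(1) finite_index by (auto simp: c_def)
    ultimately show ?thesis using hyp by (intro real_le_lsqrt) (auto simp: hyperboloid_def)
  qed
qed

lemma uniform_discrete_orbit: "uniform_discrete orbit"
proof -
  obtain h where h: "h > 1" "\<And>y. y \<in> orbit \<Longrightarrow> y \<noteq> (1, 0) \<Longrightarrow> fst y \<ge> h"
    using orbit_height_gap by blast
  have "dist x y \<ge> sqrt (2 * (h - 1))" if xy: "x \<in> orbit" "y \<in> orbit" "x \<noteq> y" for x y
  proof -
    obtain w w' where w: "set w \<subseteq> I" "x = word_act r w (1, 0)"
      and w': "set w' \<subseteq> I" "y = word_act r w' (1, 0)"
      using xy by (auto simp: orbit_def)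
    define z where "z = word_act r (rev w) y"
    have "word_act r w z = y" using w(1) by (simp add: z_def)
    then have "z \<noteq> (1, 0)" using xy(3) w(2) by auto
    moreover have "z = word_act r (rev w @ w') (1, 0)" "set (rev w @ w') \<subseteq> I"
      using w w' by (simp_all add: z_def)
    then have "z \<in> orbit" unfolding orbit_def by blast
    ultimately have "h \<le> fst z" by (rule h(2)[rotated])
    also have "fst z = - lorentz x y"
      using lorentz_word_act_left[OF w(1), of "(1, 0)" y] w(2) by (simp add: z_def)
    finally have "h \<le> - lorentz x y" .
    moreover have "lorentz x x = -1" "lorentz y y = -1"
      using xy(1,2) orbit_subset_hyperboloid by (auto simp: hyperboloid_def)
    ultimately have "2 * (h - 1) \<le> lorentz (x - y) (x - y)"
      by (simp add: lorentz_commute[of y x])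
    also have "\<dots> \<le> (norm (x - y))\<^sup>2"
      by (cases "x - y") (simp add: lorentz_self norm_Pair)
    finally show ?thesis by (simp add: dist_norm real_le_lsqrt)
  qed
  then show ?thesis using h(1) by (intro uniformI2[of "sqrt (2 * (h - 1))"]) auto
qed

lemma finite_orbit_height_le: "finite {y \<in> orbit. fst y \<le> K}"
proof -
  have "norm y \<le> 2 * K" if "y \<in> orbit" "fst y \<le> K" for y
    using norm_le_two_fst_if_hyperboloid[of y] that orbit_subset_hyperboloid by fastforce
  then have "bounded {y \<in> orbit. fst y \<le> K}" by (intro boundedI[of _ "2 * K"]) auto
  moreover have "uniform_discrete {y \<in> orbit. fst y \<le> K}"
    using uniform_discrete_orbit by (rule uniform_discrete_subset) auto
  ultimately show ?thesis using uniform_discrete_finite_iff by blast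
qed

lemma finite_roots_height_le: "finite {g \<in> roots. 0 < fst g \<and> fst g \<le> K}"
proof (rule finite_imageD)
  have height: "fst (reflect g (1, 0)) = 1 + 2 * (fst g)\<^sup>2" for g :: "real \<times> 'a"
    by (simp add: reflect_def power2_eq_square)
  have "reflect g (1, 0) \<in> {y \<in> orbit. fst y \<le> 1 + 2 * K\<^sup>2}"
    if "g \<in> roots" "0 < fst g" "fst g \<le> K" for g
    using reflect_root_base_mem_orbit[OF that(1)] power_mono[of "fst g" K 2] that
    by (simp add: height)
  then show "finite ((\<lambda>g. reflect g (1, 0)) ` {g \<in> roots. 0 < fst g \<and> fst g \<le> K})"
    by (intro finite_subset[OF _ finite_orbit_height_le[of "1 + 2 * K\<^sup>2"]]) auto
  show "inj_on (\<lambda>g. reflect g (1, 0)) {g \<in> roots. 0 < fst g \<and> fst g \<le> K}"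
  proof (rule inj_onI, clarify)
    fix t t' :: real and x x' :: 'a
    assume pos: "0 < fst (t, x)" "0 < fst (t', x')"
      and eq: "reflect (t, x) (1, 0) = reflect (t', x') (1, 0)"
    then have "t\<^sup>2 = t'\<^sup>2" using height[of "(t, x)"] height[of "(t', x')"] by simp
    then have "t = t'" using pos by (simp add: power2_eq_iff_nonneg)
    then show "t = t' \<and> x = x'" using eq pos by (simp add: reflect_def)
  qed
qed

end

lemma filterlim_at_top_if_inj_finite_sublevels:
  fixes h :: "'b \<Rightarrow> real" and f :: "nat \<Rightarrow> 'b"
  assumes "inj f" "\<And>k. f k \<in> S" "\<And>K. finite {x \<in> S. h x \<le> K}"
  shows "filterlim (\<lambda>k. h (f k)) at_top sequentially"
proof -
  have "finite {k. h (f k) \<le> K}" for K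
    using finite_vimageI[OF assms(3)[of K] assms(1)] assms(2) by (simp add: vimage_def)
  then have "\<forall>\<^sub>F k in sequentially. K < h (f k)" for K
    by (simp add: eventually_cofinite not_less flip: cofinite_eq_sequentially)
  then show ?thesis by (simp add: filterlim_at_top_dense)
qed

subsection \<open>Infinite reduced words\<close>

locale infinite_reduced_word = reflection_chamber r I
  for r :: "'i \<Rightarrow> real \<times> 'a::euclidean_space" and I :: "'i set" +
  fixes a :: "nat \<Rightarrow> 'i"
  assumes letter: "a k \<in> I"
    and reduced_initial: "reduced (map a [0..<k])"
begin

definition vertex :: "nat \<Rightarrow> real \<times> 'a" where
  "vertex k = word_act r (map a [0..<k]) (1, 0)"

definition wall :: "nat \<Rightarrow> real \<times> 'a" where
  "wall k = word_act r (map a [0..<k]) (r (a k))"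

lemma set_initial: "set (map a [j..<k]) \<subseteq> I"
  using letter by auto

lemma vertex_mem_orbit: "vertex k \<in> orbit"
  unfolding vertex_def orbit_def using set_initial by blast

lemma vertex_mem_hyperboloid: "vertex k \<in> hyperboloid"
  using vertex_mem_orbit orbit_subset_hyperboloid by blast

lemma wall_mem_roots: "wall k \<in> roots"
  unfolding wall_def roots_def using set_initial letter by blast

lemma fst_wall_pos: "fst (wall k) > 0"
  unfolding wall_def
  using reduced_initial[of k] reduced_initial[of "Suc k"]
  by (intro ascent_imp_root_pos set_initial letter) (simp add: reduced_def)

lemma fst_vertex_Suc: "fst (vertex (Suc k)) = fst (vertex k) + 2 * fst (r (a k)) * fst (wall k)"
  by (simp add: vertex_def wall_def reflect_def word_act_add word_act_scale)

lemma lorentz_wall_vertex: "lorentz (wall k) (vertex k) = - fst (r (a k))"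
  by (simp add: wall_def vertex_def lorentz_word_act[OF set_initial])

lemma lorentz_wall_vertex_pos:
  assumes "j < k"
  shows "lorentz (wall j) (vertex k) > 0"
proof -
  define y where "y = map a [Suc j..<k]"
  have "[0..<k] = [0..<j] @ j # [Suc j..<k]"
    using upt_add_eq_append[of 0 j "k - j"] assms by (simp add: upt_conv_Cons)
  then have split: "map a [0..<k] = map a [0..<j] @ a j # y" by (simp add: y_def)
  have y: "set y \<subseteq> I" "set (a j # y) \<subseteq> I" using set_initial letter by (simp_all add: y_def)
  have "reduced (a j # y)"
    using reduced_appendD2[of "map a [0..<j]" "a j # y"] reduced_initial[of k] set_initial[of 0 k]
    unfolding split by blast
  then have "word_length (rev y @ [a j]) = Suc (length y)"
    using reduced_rev[OF y(2)] by (simp add: reduced_def)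
  then have "fst (word_act r (rev y) (r (a j))) > 0"
    using y word_length_le_length[of "rev y"] by (intro ascent_imp_root_pos letter) auto
  then have "lorentz (r (a j)) (word_act r y (1, 0)) < 0"
    using y lorentz_word_act_left[of "rev y" "r (a j)" "(1, 0)"] by simp
  moreover have "lorentz (wall j) (vertex k) =
      lorentz (r (a j)) (reflect (r (a j)) (word_act r y (1, 0)))"
    unfolding wall_def vertex_def split word_act_append word_act.simps
    by (rule lorentz_word_act[OF set_initial])
  ultimately show ?thesis by (simp add: lorentz_reflect_self unit letter)
qed

lemma inj_wall: "inj wall"
proof (rule linorder_injI)
  fix j k :: nat assume "j < k"
  then have "lorentz (wall j) (vertex k) > 0" by (rule lorentz_wall_vertex_pos)
  moreover have "lorentz (wall k) (vertex k) < 0"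
    using outward[OF letter] by (simp add: lorentz_wall_vertex)
  ultimately show "wall j \<noteq> wall k" by auto
qed

lemma inj_vertex: "inj vertex"
proof -
  have "strict_mono (\<lambda>k. fst (vertex k))"
    using outward[OF letter] fst_wall_pos by (simp add: strict_mono_Suc_iff fst_vertex_Suc)
  then have "inj (fst \<circ> vertex)" by (simp add: strict_mono_imp_inj_on o_def)
  then show ?thesis by (rule inj_on_imageI2)
qed

lemma lorentz_wall_wall_gt: "lorentz (wall j) (wall k) > -1"
proof (rule ccontr)
  assume "\<not> lorentz (wall j) (wall k) > -1"
  then have "lorentz (wall j + wall k) (wall j + wall k) \<le> 0"
    using lorentz_root_self[OF wall_mem_roots] by (simp add: lorentz_commute[of "wall k" "wall j"])
  moreover have "lorentz (wall j + wall k) (1, 0) < 0"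
    using fst_wall_pos[of j] fst_wall_pos[of k] by simp
  ultimately have "lorentz (wall j + wall k) (vertex (Suc (max j k))) < 0"
    using lorentz_causal_constant_sign base_mem_hyperboloid vertex_mem_hyperboloid by blast
  moreover have "lorentz (wall j) (vertex (Suc (max j k))) > 0"
    "lorentz (wall k) (vertex (Suc (max j k))) > 0"
    by (auto intro: lorentz_wall_vertex_pos)
  ultimately show False by simp
qed

lemma filterlim_fst_wall: "filterlim (\<lambda>k. fst (wall k)) at_top sequentially"
  by (rule filterlim_at_top_if_inj_finite_sublevels[where S = "{g \<in> roots. 0 < fst g}"])
    (use inj_wall wall_mem_roots fst_wall_pos finite_roots_height_le in \<open>auto simp: conj_assoc\<close>)

lemma filterlim_fst_vertex: "filterlim (\<lambda>k. fst (vertex k)) at_top sequentially"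
  using inj_vertex vertex_mem_orbit finite_orbit_height_le
  by (rule filterlim_at_top_if_inj_finite_sublevels)

theorem convergent_direction_vertex: "convergent (\<lambda>k. direction (vertex k))"
proof -
  have wall_unit: "lorentz (wall k) (wall k) \<le> 1" for k
    using lorentz_root_self[OF wall_mem_roots] by simp
  have vertex: "fst (vertex k) > 0" "lorentz (vertex k) (vertex k) \<le> 1" for k
    using vertex_mem_hyperboloid[of k] by (simp_all add: hyperboloid_def)
  have "convergent (\<lambda>k. direction (wall k))"
    using fst_wall_pos wall_unit lorentz_wall_wall_gt[THEN less_imp_le] filterlim_fst_wall
    by (rule convergent_direction)
  then obtain p where "(\<lambda>k. direction (wall k)) \<longlonglongrightarrow> p" by (auto simp: convergent_def)
  moreover have "lorentz (vertex k) (wall k) \<ge> - Max ((\<lambda>i. fst (r i)) ` I)" for k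
    using finite_index letter by (simp add: lorentz_commute[of "vertex k"] lorentz_wall_vertex)
  ultimately have "(\<lambda>k. direction (vertex k)) \<longlonglongrightarrow> p"
    using fst_wall_pos wall_unit vertex filterlim_fst_wall filterlim_fst_vertex
    by (intro tendsto_direction_transfer[of wall vertex])
  then show ?thesis by (rule convergentI)
qed

end

section \<open>The hyperboloid model of the upper half-plane\<close>

text \<open>A line is the zero set in the half-plane of \<open>A * Re z - (R * (cmod z)\<^sup>2 + P) / 2\<close>, where the
  coefficients are normalised by \<open>A\<^sup>2 - R * P = 1\<close>.\<close>
fun line_coeffs :: "hline \<Rightarrow> real \<times> real \<times> real" where
  "line_coeffs (Vert x) = (1, 0, 2 * x)"
| "line_coeffs (Circ x r) = (- x / r, - 1 / r, (r\<^sup>2 - x\<^sup>2) / r)"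

definition line_form :: "hline \<Rightarrow> complex \<Rightarrow> real" where
  "line_form l z = (case line_coeffs l of (A, R, P) \<Rightarrow> A * Re z - (R * (cmod z)\<^sup>2 + P) / 2)"

text \<open>The Euclidean gradient of \<open>line_form\<close>.\<close>
definition line_normal :: "hline \<Rightarrow> complex \<Rightarrow> complex" where
  "line_normal l z = (case line_coeffs l of (A, R, P) \<Rightarrow> complex_of_real A - R *\<^sub>R z)"

text \<open>The hyperboloid model is normalised so that \<open>z0\<close> becomes \<open>(1, 0)\<close>; this is the isometry from
  the form \<open>A * A' - (R * P' + P * R') / 2\<close> on triples.\<close>
definition frame :: "complex \<Rightarrow> real \<times> real \<times> real \<Rightarrow> real \<times> complex" where
  "frame z0 = (\<lambda>(A, R, P).
    let S = (P - 2 * Re z0 * A + (Re z0)\<^sup>2 * R) / (2 * Im z0); T = Im z0 * R / 2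
    in (S + T, Complex (A - Re z0 * R) (S - T)))"

definition point_vec :: "complex \<Rightarrow> complex \<Rightarrow> real \<times> complex" where
  "point_vec z0 z = frame z0 (Re z / Im z, 1 / Im z, (cmod z)\<^sup>2 / Im z)"

definition line_vec :: "complex \<Rightarrow> hline \<Rightarrow> real \<times> complex" where
  "line_vec z0 l = frame z0 (line_coeffs l)"

lemma lorentz_frame:
  assumes "z0 \<in> upper"
  shows "lorentz (frame z0 (A, R, P)) (frame z0 (A', R', P')) = A * A' - (R * P' + P * R') / 2"
proof -
  define x y where "x = Re z0" and "y = Im z0"
  define S S' where "S = (P - 2 * x * A + x\<^sup>2 * R) / (2 * y)"
    and "S' = (P' - 2 * x * A' + x\<^sup>2 * R') / (2 * y)"
  have "y \<noteq> 0" using assms by (simp add: upper_def y_def)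
  then have S: "2 * y * S = P - 2 * x * A + x\<^sup>2 * R" "2 * y * S' = P' - 2 * x * A' + x\<^sup>2 * R'"
    by (simp_all add: S_def S'_def)
  have "lorentz (frame z0 (A, R, P)) (frame z0 (A', R', P')) = (A - x * R) * (A' - x * R') +
      (S - y * R / 2) * (S' - y * R' / 2) - (S + y * R / 2) * (S' + y * R' / 2)"
    by (simp add: frame_def Let_def lorentz_def inner_complex_def x_def y_def S_def S'_def)
  also have "\<dots> = (A - x * R) * (A' - x * R') - (R' * (2 * y * S) + R * (2 * y * S')) / 2"
    by (simp add: algebra_simps)
  also have "\<dots> = A * A' - (R * P' + P * R') / 2"
    unfolding S by (simp add: field_simps power2_eq_square)
  finally show ?thesis .
qed

lemma frame_add_scaleR:
  "frame z0 (A + c * A', R + c * R', P + c * P') = frame z0 (A, R, P) + c *\<^sub>R frame z0 (A', R', P')"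
  by (simp add: frame_def Let_def complex_eq_iff algebra_simps add_divide_distrib
      diff_divide_distrib)

lemma line_coeffs_normalised:
  assumes "valid_line l" "line_coeffs l = (A, R, P)"
  shows "A\<^sup>2 - R * P = 1"
proof (cases l)
  case (Circ x r)
  then have coeffs: "A = - x / r" "R = - 1 / r" "P = (r\<^sup>2 - x\<^sup>2) / r" and "r \<noteq> 0"
    using assms by auto
  then show ?thesis unfolding coeffs by (simp add: field_simps power2_eq_square)
qed (use assms in auto)

lemma lorentz_line_vec_self:
  "z0 \<in> upper \<Longrightarrow> valid_line l \<Longrightarrow> lorentz (line_vec z0 l) (line_vec z0 l) = 1"
  by (cases "line_coeffs l")
    (simp add: line_vec_def lorentz_frame line_coeffs_normalised flip: power2_eq_square)

lemma lorentz_point_vec_self: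
  assumes "z0 \<in> upper" "z \<in> upper"
  shows "lorentz (point_vec z0 z) (point_vec z0 z) = -1"
  using assms(2) by (simp add: point_vec_def lorentz_frame[OF assms(1)] upper_def cmod_power2)
    (simp add: field_simps power2_eq_square)

lemma lorentz_point_vec_line_vec:
  assumes "z0 \<in> upper" "z \<in> upper"
  shows "lorentz (point_vec z0 z) (line_vec z0 l) = line_form l z / Im z"
  using assms
  by (cases "line_coeffs l")
    (simp add: point_vec_def line_vec_def lorentz_frame line_form_def upper_def diff_divide_distrib
      add_divide_distrib algebra_simps)

lemma norm_line_normal_sq:
  assumes "valid_line l" "line_coeffs l = (A, R, P)"
  shows "(cmod (line_normal l z))\<^sup>2 = 1 - 2 * R * line_form l z"
proof -
  have "(cmod (line_normal l z))\<^sup>2 = A\<^sup>2 - 2 * R * (A * Re z - R * (cmod z)\<^sup>2 / 2)"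
    by (simp add: line_normal_def assms(2) cmod_power2) (simp add: power2_eq_square algebra_simps)
  also have "\<dots> = (A\<^sup>2 - R * P) - 2 * R * line_form l z"
    by (simp add: line_form_def assms(2) algebra_simps add_divide_distrib)
  finally show ?thesis by (simp add: line_coeffs_normalised[OF assms])
qed

lemma line_form_Circ:
  assumes "r > 0"
  shows "line_form (Circ x r) z = ((cmod (z - complex_of_real x))\<^sup>2 - r\<^sup>2) / (2 * r)"
  using assms by (simp add: line_form_def cmod_power2) (simp add: field_simps power2_eq_square)

lemma refl_eq:
  assumes "valid_line l" "z \<in> upper"
  shows "refl l z = z - (2 * line_form l z / (cmod (line_normal l z))\<^sup>2) *\<^sub>R line_normal l z"
proof (cases l)
  case (Vert x)
  then show ?thesis
    by (simp add: line_form_def line_normal_def complex_eq_iff)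
next
  case (Circ x r)
  define w where "w = z - complex_of_real x"
  have r: "r > 0" using assms(1) Circ by simp
  have "w \<noteq> 0" using assms(2) by (auto simp: w_def upper_def complex_eq_iff)
  have normal: "line_normal l z = w /\<^sub>R r"
    using r by (simp add: Circ line_normal_def w_def complex_eq_iff field_simps)
  have form: "2 * line_form l z = ((cmod w)\<^sup>2 - r\<^sup>2) / r"
    using r by (simp add: Circ line_form_Circ w_def field_simps)
  have "(2 * line_form l z / (cmod (line_normal l z))\<^sup>2) *\<^sub>R line_normal l z =
      (1 - r\<^sup>2 / (cmod w)\<^sup>2) *\<^sub>R w"
    using r \<open>w \<noteq> 0\<close> by (simp add: form normal power_divide field_simps power2_eq_square)
  moreover have "refl l z = complex_of_real x + (r\<^sup>2 / (cmod w)\<^sup>2) *\<^sub>R w"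
  proof -
    have "cnj z - complex_of_real x = cnj w" by (simp add: w_def)
    moreover have "1 / cnj w = w / complex_of_real ((cmod w)\<^sup>2)"
      using \<open>w \<noteq> 0\<close> complex_norm_square[of w] by (simp add: field_simps)
    ultimately show ?thesis
      by (simp add: Circ scaleR_conv_of_real divide_inverse mult_ac)
  qed
  ultimately show ?thesis
    by (simp only: scaleR_diff_left scaleR_one) (simp add: w_def)
qed

lemma line_normal_nonzero:
  assumes "valid_line l" "z \<in> upper"
  shows "line_normal l z \<noteq> 0"
  using assms by (cases l) (auto simp: line_normal_def upper_def complex_eq_iff)

lemma Im_refl:
  assumes "valid_line l" "z \<in> upper"
  shows "Im (refl l z) = Im z / (cmod (line_normal l z))\<^sup>2"
proof (cases "line_coeffs l")
  case (fields A R P)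
  define f n where "f = line_form l z" and "n = (cmod (line_normal l z))\<^sup>2"
  have n: "n \<noteq> 0" using line_normal_nonzero[OF assms] by (simp add: n_def)
  have sum: "n + 2 * R * f = 1"
    unfolding n_def f_def norm_line_normal_sq[OF assms(1) fields] by simp
  have "Im (refl l z) = Im z + 2 * f / n * (R * Im z)"
    unfolding refl_eq[OF assms] f_def n_def by (simp add: line_normal_def fields)
  also have "\<dots> = (n + 2 * R * f) * Im z / n"
    using n by (simp add: field_simps)
  finally show ?thesis unfolding sum by (simp add: n_def)
qed

lemma Re_refl:
  assumes "valid_line l" "z \<in> upper" "line_coeffs l = (A, R, P)"
  shows "Re (refl l z) = (Re z - 2 * A * line_form l z) / (cmod (line_normal l z))\<^sup>2"
proof -
  define f n where "f = line_form l z" and "n = (cmod (line_normal l z))\<^sup>2"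
  have n: "n \<noteq> 0" using line_normal_nonzero[OF assms(1,2)] by (simp add: n_def)
  have sum: "n + 2 * R * f = 1"
    unfolding n_def f_def norm_line_normal_sq[OF assms(1,3)] by simp
  have "Re (refl l z) = Re z - 2 * f / n * (A - R * Re z)"
    unfolding refl_eq[OF assms(1,2)] f_def n_def by (simp add: line_normal_def assms(3))
  also have "\<dots> = ((n + 2 * R * f) * Re z - 2 * A * f) / n"
    using n by (simp add: field_simps)
  finally show ?thesis unfolding sum by (simp add: n_def f_def)
qed

lemma norm_refl_sq:
  assumes "valid_line l" "z \<in> upper" "line_coeffs l = (A, R, P)"
  shows "(cmod (refl l z))\<^sup>2 = ((cmod z)\<^sup>2 - 2 * P * line_form l z) / (cmod (line_normal l z))\<^sup>2"
proof -
  define f n w where "f = line_form l z" and "n = (cmod (line_normal l z))\<^sup>2"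
    and "w = line_normal l z"
  define t where "t = 2 * f / n"
  have "n \<noteq> 0" using line_normal_nonzero[OF assms(1,2)] by (simp add: n_def)
  then have t: "t * n = 2 * f" by (simp add: t_def)
  have n: "n = w \<bullet> w" by (simp add: n_def w_def dot_square_norm)
  have sum: "n + 2 * R * f = 1"
    unfolding n_def f_def norm_line_normal_sq[OF assms(1,3)] by simp
  have inner: "2 * (z \<bullet> w) = 2 * f + P - R * (cmod z)\<^sup>2"
    by (simp add: f_def line_form_def w_def line_normal_def assms(3) inner_diff_right
        dot_square_norm)
      (simp add: inner_complex_def field_simps)
  have "(cmod (refl l z))\<^sup>2 = (z - t *\<^sub>R w) \<bullet> (z - t *\<^sub>R w)"
    unfolding refl_eq[OF assms(1,2)] t_def f_def n_def w_def by (simp add: dot_square_norm)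
  also have "\<dots> = (cmod z)\<^sup>2 - t * (2 * (z \<bullet> w)) + t\<^sup>2 * n"
    unfolding n inner_diff_left inner_diff_right
    by (simp add: inner_commute[of w z] dot_square_norm algebra_simps)
  also have "\<dots> = (cmod z)\<^sup>2 - t * (P - R * (cmod z)\<^sup>2)"
  proof -
    have "t\<^sup>2 * n = t * (2 * f)" unfolding t[symmetric] by (simp add: power2_eq_square)
    then show ?thesis unfolding inner by (simp add: algebra_simps)
  qed
  also have "\<dots> = ((n + 2 * R * f) * (cmod z)\<^sup>2 - 2 * P * f) / n"
    using \<open>n \<noteq> 0\<close> by (simp add: t_def field_simps)
  finally show ?thesis unfolding sum by (simp add: n_def f_def)
qed

lemma refl_mem_upper: "valid_line l \<Longrightarrow> z \<in> upper \<Longrightarrow> refl l z \<in> upper"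
  using line_normal_nonzero[of l z] by (simp add: upper_def Im_refl del: refl.simps)

lemma point_vec_refl:
  assumes "z0 \<in> upper" "z \<in> upper" "valid_line l"
  shows "point_vec z0 (refl l z) = reflect (line_vec z0 l) (point_vec z0 z)"
proof -
  obtain A R P where coeffs: "line_coeffs l = (A, R, P)" by (cases "line_coeffs l")
  define n where "n = (cmod (line_normal l z))\<^sup>2"
  define c where "c = - 2 * (line_form l z / Im z)"
  have y: "Im z > 0" using assms(2) by (simp add: upper_def)
  have "n \<noteq> 0" using line_normal_nonzero[OF assms(3,2)] by (simp add: n_def)
  note coords = Im_refl[OF assms(3,2)] Re_refl[OF assms(3,2) coeffs]
    norm_refl_sq[OF assms(3,2) coeffs]
  have "n = 1 - 2 * R * line_form l z"
    unfolding n_def by (rule norm_line_normal_sq[OF assms(3) coeffs])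
  then have "1 / Im (refl l z) = 1 / Im z + c * R"
    using y unfolding coords(1) n_def[symmetric] by (simp add: c_def diff_divide_distrib)
  moreover have "Re (refl l z) / Im (refl l z) = Re z / Im z + c * A"
    using y \<open>n \<noteq> 0\<close> unfolding coords(1,2) n_def[symmetric] by (simp add: c_def field_simps)
  moreover have "(cmod (refl l z))\<^sup>2 / Im (refl l z) = (cmod z)\<^sup>2 / Im z + c * P"
    using y \<open>n \<noteq> 0\<close> unfolding coords(1,3) n_def[symmetric] by (simp add: c_def field_simps)
  ultimately have "point_vec z0 (refl l z) = point_vec z0 z + c *\<^sub>R line_vec z0 l"
    by (simp only: point_vec_def line_vec_def coeffs frame_add_scaleR)
  then show ?thesis
    using assms by (simp add: reflect_def lorentz_point_vec_line_vec c_def)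
qed

lemma line_set_eq:
  assumes "valid_line l"
  shows "line_set l = {z \<in> upper. line_form l z = 0}"
proof (cases l)
  case (Circ x r)
  then have "cmod (z - complex_of_real x) = r \<longleftrightarrow> line_form l z = 0" for z
    using assms by (simp add: line_form_Circ power2_eq_iff_nonneg)
  then show ?thesis by (simp add: Circ)
qed (simp add: line_form_def)

lemma line_tangent_eq: "valid_line l \<Longrightarrow> line_tangent l p = \<i> * line_normal l p"
  by (cases l) (auto simp: line_normal_def complex_eq_iff field_simps)

lemma norm_line_normal:
  assumes "valid_line l" "p \<in> line_set l"
  shows "cmod (line_normal l p) = 1"
proof (cases "line_coeffs l")
  case (fields A R P)
  have "(cmod (line_normal l p))\<^sup>2 = 1"
    using norm_line_normal_sq[OF assms(1) fields, of p] assms by (simp add: line_set_eq)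
  then show ?thesis using norm_ge_zero[of "line_normal l p"] by (simp add: power2_eq_1_iff)
qed

text \<open>The model is conformal.\<close>
lemma lorentz_line_vec_line_vec:
  assumes "z0 \<in> upper" "valid_line l" "valid_line l'" "p \<in> line_set l" "p \<in> line_set l'"
  shows "lorentz (line_vec z0 l) (line_vec z0 l') = line_normal l p \<bullet> line_normal l' p"
proof -
  obtain A R P A' R' P' where coeffs: "line_coeffs l = (A, R, P)" "line_coeffs l' = (A', R', P')"
    by (metis prod_cases3)
  define N where "N = (cmod p)\<^sup>2"
  have zero: "2 * A * Re p = R * N + P" "2 * A' * Re p = R' * N + P'"
    using assms coeffs by (simp_all add: line_set_eq line_form_def N_def)
  have "line_normal l p \<bullet> line_normal l' p =
      A * A' - (R' * (2 * A * Re p) + R * (2 * A' * Re p)) / 2 + R * R' * N"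
    by (simp add: line_normal_def coeffs inner_complex_def N_def cmod_power2)
      (simp add: power2_eq_square algebra_simps)
  also have "\<dots> = A * A' - (R * P' + P * R') / 2"
    unfolding zero by (simp add: algebra_simps)
  also have "\<dots> = lorentz (line_vec z0 l) (line_vec z0 l')"
    using assms(1) by (simp add: line_vec_def coeffs lorentz_frame)
  finally show ?thesis by simp
qed

lemma point_vec_base: "z0 \<in> upper \<Longrightarrow> point_vec z0 z0 = (1, 0)"
  by (simp add: point_vec_def frame_def upper_def Let_def cmod_power2 complex_eq_iff)
    (simp add: field_simps power2_eq_square)

lemma point_vec_eq:
  assumes "z0 \<in> upper" "z \<in> upper"
  shows "fst (point_vec z0 z) - Im (snd (point_vec z0 z)) = Im z0 / Im z"
    and "fst (point_vec z0 z) + Im (snd (point_vec z0 z)) =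
        (cmod (z - complex_of_real (Re z0)))\<^sup>2 / (Im z * Im z0)"
    and "Re (snd (point_vec z0 z)) = (Re z - Re z0) / Im z"
  using assms
  by (simp_all add: point_vec_def frame_def upper_def Let_def cmod_power2)
    (simp_all add: field_simps power2_eq_square)

lemma fst_point_vec_pos:
  assumes "z0 \<in> upper" "z \<in> upper"
  shows "fst (point_vec z0 z) > 0"
proof -
  have "2 * fst (point_vec z0 z) =
      Im z0 / Im z + (cmod (z - complex_of_real (Re z0)))\<^sup>2 / (Im z * Im z0)"
    unfolding point_vec_eq[OF assms, symmetric] by simp
  also have "\<dots> > 0" using assms by (simp add: upper_def add_pos_nonneg)
  finally show ?thesis by simp
qed

lemma bij_betw_point_vec:
  assumes "z0 \<in> upper"
  shows "bij_betw (point_vec z0) upper hyperboloid"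
proof (rule bij_betw_byWitness)
  let ?inv = "\<lambda>v. let y = Im z0 / (fst v - Im (snd v)) in Complex (Re z0 + y * Re (snd v)) y"
  have y: "Im z0 > 0" using assms by (simp add: upper_def)
  show "\<forall>z\<in>upper. ?inv (point_vec z0 z) = z"
    using assms y by (auto simp: point_vec_eq Let_def complex_eq_iff upper_def)
  show "point_vec z0 ` upper \<subseteq> hyperboloid"
    using assms fst_point_vec_pos lorentz_point_vec_self by (auto simp: hyperboloid_def)
  have pos: "fst v - Im (snd v) > 0" if "v \<in> hyperboloid" for v :: "real \<times> complex"
    using norm_snd_less_fst[OF that] abs_Im_le_cmod[of "snd v"] by linarith
  then show "?inv ` hyperboloid \<subseteq> upper"
    using y by (auto simp: upper_def Let_def)
  show "\<forall>v\<in>hyperboloid. point_vec z0 (?inv v) = v"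
  proof
    fix v :: "real \<times> complex" assume v: "v \<in> hyperboloid"
    define z where "z = ?inv v"
    define d where "d = fst v - Im (snd v)"
    have d: "d > 0" using pos[OF v] by (simp add: d_def)
    have z: "Re z = Re z0 + Im z * Re (snd v)" "Im z = Im z0 / d"
      by (simp_all add: z_def Let_def d_def)
    then have "z \<in> upper" using y d by (simp add: upper_def)
    note eq = point_vec_eq[OF assms this]
    have "(Re (snd v))\<^sup>2 + 1 = d * (fst v + Im (snd v))"
      using norm_snd_hyperboloid_sq[OF v]
      by (simp add: d_def cmod_power2) (simp add: power2_eq_square algebra_simps)
    moreover have "(cmod (z - complex_of_real (Re z0)))\<^sup>2 = (Im z)\<^sup>2 * ((Re (snd v))\<^sup>2 + 1)"
      by (simp add: cmod_power2 z(1) power_mult_distrib algebra_simps)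
    ultimately have norm: "(cmod (z - complex_of_real (Re z0)))\<^sup>2 =
        (Im z)\<^sup>2 * (d * (fst v + Im (snd v)))"
      by simp
    have "fst (point_vec z0 z) + Im (snd (point_vec z0 z)) = fst v + Im (snd v)"
      unfolding eq(2) norm z(2) using y d by (simp add: field_simps power2_eq_square)
    moreover have "fst (point_vec z0 z) - Im (snd (point_vec z0 z)) = fst v - Im (snd v)"
      unfolding eq(1) z(2) using y d by (simp add: d_def)
    moreover have "Re (snd (point_vec z0 z)) = Re (snd v)"
      unfolding eq(3) using z y d by simp
    ultimately show "point_vec z0 (?inv v) = v"
      unfolding z_def[symmetric] by (simp add: prod_eq_iff complex_eq_iff)
  qed
qed

subsection \<open>Intersecting lines\<close>

definition lorentz_cross :: "real \<times> complex \<Rightarrow> real \<times> complex \<Rightarrow> real \<times> complex" where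
  "lorentz_cross u v =
    (Im (snd u) * Re (snd v) - Re (snd u) * Im (snd v),
     Complex (Im (snd u) * fst v - fst u * Im (snd v)) (fst u * Re (snd v) - Re (snd u) * fst v))"

lemma lorentz_cross_orthogonal:
  "lorentz u (lorentz_cross u v) = 0" "lorentz v (lorentz_cross u v) = 0"
  by (simp_all add: lorentz_def lorentz_cross_def inner_complex_def algebra_simps)

lemma lorentz_cross_self:
  "lorentz (lorentz_cross u v) (lorentz_cross u v) = (lorentz u v)\<^sup>2 - lorentz u u * lorentz v v"
  by (simp add: lorentz_def lorentz_cross_def inner_complex_def power2_eq_square algebra_simps)

lemma exists_orthogonal_hyperboloid_point:
  fixes a b :: "real \<times> complex"
  assumes "lorentz a a = 1" "lorentz b b = 1" "\<bar>lorentz a b\<bar> < 1"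
  obtains v where "v \<in> hyperboloid" "lorentz a v = 0" "lorentz b v = 0"
proof -
  define c where "c = lorentz_cross a b"
  define N where "N = - lorentz c c"
  have "N > 0"
    using assms abs_square_less_1[of "lorentz a b"] by (simp add: N_def c_def lorentz_cross_self)
  have "(fst c)\<^sup>2 = N + (norm (snd c))\<^sup>2" by (simp add: N_def lorentz_self)
  then have "fst c \<noteq> 0" using \<open>N > 0\<close> zero_le_power2[of "norm (snd c)"] by fastforce
  define v where "v = (sgn (fst c) / sqrt N) *\<^sub>R c"
  have "(sgn (fst c))\<^sup>2 = 1" using \<open>fst c \<noteq> 0\<close> by (simp add: sgn_if)
  then have "lorentz v v = -1"
    using \<open>N > 0\<close> by (simp add: v_def N_def power_divide flip: power2_eq_square mult.assoc)
  moreover have "fst v > 0"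
    using \<open>fst c \<noteq> 0\<close> \<open>N > 0\<close> by (simp add: v_def sgn_if)
  ultimately have "v \<in> hyperboloid" by (simp add: hyperboloid_def)
  moreover have "lorentz a v = 0" "lorentz b v = 0"
    by (simp_all add: v_def c_def lorentz_cross_orthogonal)
  ultimately show ?thesis using that by blast
qed

lemma lines_intersect:
  assumes z0: "z0 \<in> upper" and l: "valid_line l" "valid_line l'"
    and "\<bar>lorentz (line_vec z0 l) (line_vec z0 l')\<bar> < 1"
  shows "line_set l \<inter> line_set l' \<noteq> {}"
proof -
  obtain v where v: "v \<in> hyperboloid"
      "lorentz (line_vec z0 l) v = 0" "lorentz (line_vec z0 l') v = 0"
    using exists_orthogonal_hyperboloid_point lorentz_line_vec_self z0 l assms(4) by metis
  then obtain z where z: "z \<in> upper" "v = point_vec z0 z"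
    using bij_betw_imp_surj_on[OF bij_betw_point_vec[OF z0]] by blast
  have "line_form k z = 0" if "lorentz (line_vec z0 k) v = 0" for k
    using that z lorentz_point_vec_line_vec[OF z0 z(1), of k]
    by (simp add: lorentz_commute[of "line_vec z0 k"] upper_def)
  then have "z \<in> line_set l \<inter> line_set l'"
    using v z l by (simp add: line_set_eq)
  then show ?thesis by blast
qed

lemma line_set_nonempty:
  assumes "valid_line l"
  shows "line_set l \<noteq> {}"
proof (cases l)
  case (Vert x)
  then have "Complex x 1 \<in> line_set l" by (simp add: upper_def)
  then show ?thesis by blast
next
  case (Circ x r)
  then have "Complex x r \<in> line_set l" using assms by (simp add: upper_def cmod_def)
  then show ?thesis by blast
qed

subsection \<open>Outward normals\<close>

definition outward_vec :: "complex \<Rightarrow> hline \<Rightarrow> real \<times> complex" where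
  "outward_vec z0 l = (- sgn (line_form l z0)) *\<^sub>R line_vec z0 l"

lemma lorentz_outward_vec_point_vec:
  assumes "z0 \<in> upper" "z \<in> upper"
  shows "lorentz (outward_vec z0 l) (point_vec z0 z) =
      - sgn (line_form l z0) * line_form l z / Im z"
  using assms
  by (simp add: outward_vec_def lorentz_commute[of "line_vec z0 l"] lorentz_point_vec_line_vec)

lemma lorentz_outward_vec_eq_0:
  assumes "z0 \<in> upper" "valid_line l" "p \<in> line_set l"
  shows "lorentz (outward_vec z0 l) (point_vec z0 p) = 0"
  using assms by (simp add: line_set_eq lorentz_outward_vec_point_vec)

lemma abs_lorentz_outward_vec:
  assumes "line_form l z0 \<noteq> 0" "line_form l' z0 \<noteq> 0"
  shows "\<bar>lorentz (outward_vec z0 l) (outward_vec z0 l')\<bar> =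
      \<bar>lorentz (line_vec z0 l) (line_vec z0 l')\<bar>"
  using assms by (simp add: outward_vec_def sgn_if)

lemma lorentz_outward_vec_self:
  assumes "z0 \<in> upper" "valid_line l" "line_form l z0 \<noteq> 0"
  shows "lorentz (outward_vec z0 l) (outward_vec z0 l) = 1"
  using assms by (simp add: outward_vec_def lorentz_line_vec_self sgn_if)

lemma fst_outward_vec_pos:
  assumes "z0 \<in> upper" "line_form l z0 \<noteq> 0"
  shows "fst (outward_vec z0 l) > 0"
proof -
  have "fst (outward_vec z0 l) = \<bar>line_form l z0\<bar> / Im z0"
    using lorentz_outward_vec_point_vec[OF assms(1,1), of l] assms(1)
    by (simp add: point_vec_base abs_sgn mult.commute)
  then show ?thesis using assms by (simp add: upper_def)
qed

lemma reflect_outward_vec: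
  "line_form l z0 \<noteq> 0 \<Longrightarrow> reflect (outward_vec z0 l) = reflect (line_vec z0 l)"
  by (auto simp: reflect_def outward_vec_def sgn_if)

lemma continuous_on_line_form [continuous_intros]: "continuous_on S (line_form l)"
  unfolding line_form_def[abs_def]
  by (cases "line_coeffs l") (auto intro!: continuous_intros)

lemma connected_sgn_eq:
  fixes f :: "'a::topological_space \<Rightarrow> real"
  assumes "connected C" "continuous_on C f" "\<And>z. z \<in> C \<Longrightarrow> f z \<noteq> 0" "a \<in> C" "b \<in> C"
  shows "sgn (f a) = sgn (f b)"
proof (rule ccontr)
  assume "sgn (f a) \<noteq> sgn (f b)"
  then have "f a < 0 \<and> 0 < f b \<or> f b < 0 \<and> 0 < f a"
    using assms(3)[OF assms(4)] assms(3)[OF assms(5)] by (auto simp: sgn_if split: if_splits)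
  moreover have "connected (f ` C)" using assms(1,2) by (intro connected_continuous_image)
  ultimately have "0 \<in> f ` C"
    using connectedD_interval[of "f ` C" "f a" "f b" 0]
      connectedD_interval[of "f ` C" "f b" "f a" 0] assms(4,5)
    by auto
  then show False using assms(3) by auto
qed

lemma unit_normal_eq_if_inner_nonpos:
  assumes "cmod d = 1" "\<nu> \<in> {\<i> * d, - (\<i> * d)}" "\<nu> \<bullet> (d * cis \<theta>) \<le> 0" "sin \<theta> \<noteq> 0"
  shows "\<nu> = - sgn (sin \<theta>) *\<^sub>R (\<i> * d)"
proof -
  have "(Re d)\<^sup>2 + (Im d)\<^sup>2 = 1" using assms(1) cmod_power2[of d] by simp
  moreover have "(\<i> * d) \<bullet> (d * cis \<theta>) = ((Re d)\<^sup>2 + (Im d)\<^sup>2) * sin \<theta>"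
    by (simp add: inner_complex_def power2_eq_square algebra_simps)
  ultimately have "(\<i> * d) \<bullet> (d * cis \<theta>) = sin \<theta>" by simp
  then show ?thesis using assms(2-4) by (auto simp: sgn_if)
qed

locale side_of_line =
  fixes l :: hline and C :: "complex set" and z0 :: complex
  assumes valid: "valid_line l" and connected: "connected C"
    and avoids: "C \<subseteq> upper - line_set l" and base: "z0 \<in> C"
begin

lemma line_form_nonzero: "z \<in> C \<Longrightarrow> line_form l z \<noteq> 0"
  using avoids line_set_eq[OF valid] by auto

lemma sgn_mult_line_form_pos: "z \<in> C \<Longrightarrow> sgn (line_form l z0) * line_form l z > 0"
  using connected_sgn_eq[OF connected continuous_on_line_form line_form_nonzero base, of z]
    line_form_nonzero[of z]
  by (simp add: sgn_if split: if_splits)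

lemma lorentz_outward_vec_frontier_neg:
  assumes "p \<in> frontier C" "p \<in> upper" "p \<notin> line_set l"
  shows "lorentz (outward_vec z0 l) (point_vec z0 p) < 0"
proof -
  have "closed {z. 0 \<le> sgn (line_form l z0) * line_form l z}"
    by (intro closed_Collect_le continuous_intros)
  then have "closure C \<subseteq> {z. 0 \<le> sgn (line_form l z0) * line_form l z}"
    by (rule closure_minimal[rotated]) (auto intro: less_imp_le sgn_mult_line_form_pos)
  then have "0 \<le> sgn (line_form l z0) * line_form l p"
    using assms(1) by (auto simp: frontier_def)
  moreover have "line_form l p \<noteq> 0" using assms(2,3) line_set_eq[OF valid] by auto
  ultimately have "0 < sgn (line_form l z0) * line_form l p"
    using line_form_nonzero[OF base] by (simp add: less_le sgn_zero_iff)
  moreover have "z0 \<in> upper" using base avoids by blast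
  ultimately show ?thesis using assms(2) by (simp add: lorentz_outward_vec_point_vec upper_def)
qed

lemma sgn_mult_inner_line_normal_nonneg:
  assumes p: "p \<in> line_set l" and enters: "\<forall>\<^sub>F e in at_right 0. p + e *\<^sub>R d \<in> C"
  shows "sgn (line_form l z0) * (line_normal l p \<bullet> d) \<ge> 0"
proof (rule tendsto_lowerbound)
  obtain A R P where coeffs: "line_coeffs l = (A, R, P)" by (cases "line_coeffs l")
  have "((\<lambda>e. line_form l (p + e *\<^sub>R d)) has_real_derivative line_normal l p \<bullet> d) (at 0)"
    unfolding line_form_def line_normal_def coeffs cmod_power2
    by (auto intro!: derivative_eq_intros simp: inner_complex_def algebra_simps)
  then have "((\<lambda>e. line_form l (p + e *\<^sub>R d) / e) \<longlongrightarrow> line_normal l p \<bullet> d) (at 0)"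
    using p valid by (simp add: DERIV_def line_set_eq)
  then show "((\<lambda>e. sgn (line_form l z0) * (line_form l (p + e *\<^sub>R d) / e)) \<longlongrightarrow>
      sgn (line_form l z0) * (line_normal l p \<bullet> d)) (at_right 0)"
    by (intro tendsto_intros) (auto intro: tendsto_within_subset)
  have "\<forall>\<^sub>F e in at_right 0. e > (0::real)" by (simp add: eventually_at_right_less)
  with enters show "\<forall>\<^sub>F e in at_right 0. 0 \<le> sgn (line_form l z0) * (line_form l (p + e *\<^sub>R d) / e)"
  proof eventually_elim
    case (elim e)
    then show ?case using sgn_mult_line_form_pos[OF elim(1)] by simp
  qed
qed simp

lemma outward_normal_eq:
  assumes p: "p \<in> line_set l" and d: "d \<in> {line_tangent l p, - line_tangent l p}"
    and enters: "\<forall>\<^sub>F e in at_right 0. p + e *\<^sub>R (d * cis \<theta>) \<in> C" and "sin \<theta> \<noteq> 0"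
  shows "- sgn (line_form l z0) *\<^sub>R line_normal l p = - sgn (sin \<theta>) *\<^sub>R (\<i> * d)"
proof (rule unit_normal_eq_if_inner_nonpos)
  show "cmod d = 1" using d valid p by (auto simp: line_tangent_eq norm_mult norm_line_normal)
  show "- sgn (line_form l z0) *\<^sub>R line_normal l p \<in> {\<i> * d, - (\<i> * d)}"
    using d line_form_nonzero[OF base] valid by (auto simp: line_tangent_eq sgn_if)
  show "(- sgn (line_form l z0) *\<^sub>R line_normal l p) \<bullet> (d * cis \<theta>) \<le> 0"
    using sgn_mult_inner_line_normal_nonneg[OF p enters] by simp
qed fact

end

lemma cond_disjoint_coxeter_product:
  assumes z0: "z0 \<in> upper" and l: "valid_line l" "valid_line l'"
    and disjoint: "cond_disjoint l l' z0"
  shows "line_form l z0 \<noteq> 0 \<and> coxeter_product (lorentz (outward_vec z0 l) (outward_vec z0 l'))"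
proof -
  obtain C where C: "C \<in> components (upper - (line_set l \<union> line_set l'))" "z0 \<in> C"
      "line_set l \<subseteq> frontier C" "line_set l' \<subseteq> frontier C"
    and empty: "line_set l \<inter> line_set l' = {}"
    using disjoint by (auto simp: cond_disjoint_def)
  have side: "connected C" "C \<subseteq> upper - (line_set l \<union> line_set l')"
    using in_components_connected[OF C(1)] in_components_subset[OF C(1)] by auto
  interpret l: side_of_line l C z0 using l C(2) side by unfold_locales auto
  interpret l': side_of_line l' C z0 using l C(2) side by unfold_locales auto
  note nonzero = l.line_form_nonzero[OF C(2)] l'.line_form_nonzero[OF C(2)]
  obtain p p' where p: "p \<in> line_set l" "p \<notin> line_set l'"
    and p': "p' \<in> line_set l'" "p' \<notin> line_set l"
    using line_set_nonempty l empty by blast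
  then have upper: "p \<in> upper" "p' \<in> upper" using line_set_eq l by auto
  have "lorentz (outward_vec z0 l) (outward_vec z0 l') < 1"
  proof (rule lorentz_less_one_if_separated)
    show "point_vec z0 p \<in> hyperboloid" "point_vec z0 p' \<in> hyperboloid"
      using bij_betwE[OF bij_betw_point_vec[OF z0]] upper by blast+
    show "lorentz (outward_vec z0 l) (point_vec z0 p') < 0"
      "lorentz (outward_vec z0 l') (point_vec z0 p) < 0"
      using C(3,4) p p' upper
      by (auto intro: l.lorentz_outward_vec_frontier_neg l'.lorentz_outward_vec_frontier_neg)
    show "lorentz (outward_vec z0 l) (outward_vec z0 l) = 1"
      "lorentz (outward_vec z0 l') (outward_vec z0 l') = 1"
      using z0 l nonzero by (simp_all add: lorentz_outward_vec_self)
  qed (use z0 l p p' in \<open>simp_all only: lorentz_outward_vec_eq_0\<close>)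
  moreover have "\<bar>lorentz (outward_vec z0 l) (outward_vec z0 l')\<bar> \<ge> 1"
    unfolding abs_lorentz_outward_vec[OF nonzero] using lines_intersect[OF z0 l] empty by fastforce
  ultimately have "lorentz (outward_vec z0 l) (outward_vec z0 l') \<le> -1" by linarith
  then show ?thesis using nonzero by (simp add: coxeter_product_def)
qed

lemma angle_coxeter_product:
  assumes z0: "z0 \<in> upper" and l: "valid_line l" "valid_line l'" and m: "m \<ge> 2"
    and p: "p \<in> line_set l" "p \<in> line_set l'"
    and d: "d \<in> {line_tangent l p, - line_tangent l p}"
      "d' \<in> {line_tangent l' p, - line_tangent l' p}"
    and angle: "d' = d * cis (pi / real m)"
    and enters: "\<forall>\<^sub>F e in at_right 0. p + complex_of_real e * d * cis (pi / (2 * real m))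
                 \<in> connected_component_set (upper - (line_set l \<union> line_set l')) z0"
  shows "line_form l z0 \<noteq> 0 \<and> line_form l' z0 \<noteq> 0 \<and>
    coxeter_product (lorentz (outward_vec z0 l) (outward_vec z0 l'))"
proof -
  define C where "C = connected_component_set (upper - (line_set l \<union> line_set l')) z0"
  define \<theta> where "\<theta> = pi / (2 * real m)"
  have enters': "\<forall>\<^sub>F e in at_right 0. p + e *\<^sub>R (d * cis \<theta>) \<in> C"
    using enters by (simp add: C_def \<theta>_def scaleR_conv_of_real mult.assoc)
  then have "C \<noteq> {}" using eventually_happens'[OF trivial_limit_at_right_real] by blast
  then have C: "connected C" "C \<subseteq> upper - (line_set l \<union> line_set l')" "z0 \<in> C"
    unfolding C_def connected_component_eq_empty by (simp_all add: connected_component_subset)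
  interpret l: side_of_line l C z0 using l C by unfold_locales auto
  interpret l': side_of_line l' C z0 using l C by unfold_locales auto
  note nonzero = l.line_form_nonzero[OF C(3)] l'.line_form_nonzero[OF C(3)]
  have sin: "sin \<theta> > 0" using m by (intro sin_gt_zero) (auto simp: \<theta>_def field_simps)
  have "d * cis \<theta> = d' * cis (- \<theta>)"
    by (simp add: angle \<theta>_def cis_mult mult.assoc)
  then have "- sgn (line_form l' z0) *\<^sub>R line_normal l' p = - sgn (sin (- \<theta>)) *\<^sub>R (\<i> * d')"
    using enters' sin by (intro l'.outward_normal_eq p d) simp_all
  moreover have "- sgn (line_form l z0) *\<^sub>R line_normal l p = - sgn (sin \<theta>) *\<^sub>R (\<i> * d)"
    using enters' sin by (intro l.outward_normal_eq p d) simp_all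
  moreover have "lorentz (outward_vec z0 l) (outward_vec z0 l') =
      (- sgn (line_form l z0) *\<^sub>R line_normal l p) \<bullet> (- sgn (line_form l' z0) *\<^sub>R line_normal l' p)"
    by (simp add: outward_vec_def lorentz_line_vec_line_vec[OF z0 l p])
  ultimately have "lorentz (outward_vec z0 l) (outward_vec z0 l') = - (d \<bullet> d')"
    using sin by (simp add: inner_complex_def)
  also have "d \<bullet> d' = (cmod d)\<^sup>2 * cos (pi / real m)"
    by (simp add: angle inner_complex_def cmod_power2) (simp add: algebra_simps power2_eq_square)
  also have "cmod d = 1" using d(1) l p by (auto simp: line_tangent_eq norm_mult norm_line_normal)
  finally show ?thesis using nonzero m by (auto simp: coxeter_product_def)
qed

lemma cond_angle_coxeter_product:
  assumes z0: "z0 \<in> upper" and l: "valid_line l" "valid_line l'" and angle: "cond_angle l l' z0"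
  shows "line_form l z0 \<noteq> 0 \<and> coxeter_product (lorentz (outward_vec z0 l) (outward_vec z0 l'))"
proof -
  obtain p m d d' where m: "m \<ge> 2" and inter: "line_set l \<inter> line_set l' = {p}"
    and d: "d \<in> {line_tangent l p, - line_tangent l p}"
      "d' \<in> {line_tangent l' p, - line_tangent l' p}"
    and alternatives: "(d' = d * cis (pi / real m) \<and>
             (\<forall>\<^sub>F \<epsilon> in at_right 0. p + complex_of_real \<epsilon> * d * cis (pi / (2 * real m))
                 \<in> connected_component_set (upper - (line_set l \<union> line_set l')) z0))
        \<or> (d = d' * cis (pi / real m) \<and>
             (\<forall>\<^sub>F \<epsilon> in at_right 0. p + complex_of_real \<epsilon> * d' * cis (pi / (2 * real m))
                 \<in> connected_component_set (upper - (line_set l \<union> line_set l')) z0))"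
    using angle unfolding cond_angle_def by blast
  have p: "p \<in> line_set l" "p \<in> line_set l'" using inter by auto
  show ?thesis
    using alternatives angle_coxeter_product[OF z0 l m p d]
      angle_coxeter_product[OF z0 l(2,1) m p(2,1) d(2,1)]
    by (auto simp: Un_commute[of "line_set l'"] lorentz_commute[of "outward_vec z0 l'"])
qed

subsection \<open>Boundary limits\<close>

lemma point_eq_of_direction:
  assumes "z0 \<in> upper" "z \<in> upper"
  defines "h \<equiv> fst (point_vec z0 z)" and "q \<equiv> direction (point_vec z0 z)"
  shows "Im q < 1"
    and "Im z = Im z0 * inverse h / (1 - Im q)"
    and "Re z = Re z0 + Im z0 * Re q / (1 - Im q)"
    and "(cmod (z - complex_of_real (Re z0)))\<^sup>2 = (Im z0)\<^sup>2 * (1 + Im q) * inverse (1 - Im q)"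
proof -
  have y: "Im z0 > 0" "Im z > 0" using assms by (simp_all add: upper_def)
  have h: "h > 0" using fst_point_vec_pos[OF assms(1,2)] by (simp add: h_def)
  have "snd (point_vec z0 z) = h *\<^sub>R q" using h by (simp add: q_def h_def direction_def)
  then have eq: "h * (1 - Im q) = Im z0 / Im z"
      "h * (1 + Im q) = (cmod (z - complex_of_real (Re z0)))\<^sup>2 / (Im z * Im z0)"
      "h * Re q = (Re z - Re z0) / Im z"
    using point_vec_eq[OF assms(1,2)] by (simp_all add: h_def[symmetric] algebra_simps)
  have "h * (1 - Im q) > 0" unfolding eq(1) using y by simp
  then show q: "Im q < 1" using h by (simp add: zero_less_mult_iff)
  then show im: "Im z = Im z0 * inverse h / (1 - Im q)"
    using eq(1) y h by (simp add: field_simps)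
  have "Re z - Re z0 = h * Re q * Im z" using eq(3) y by (simp add: field_simps)
  also have "\<dots> = Im z0 * Re q / (1 - Im q)" unfolding im using h by simp
  finally show "Re z = Re z0 + Im z0 * Re q / (1 - Im q)" by simp
  have "(cmod (z - complex_of_real (Re z0)))\<^sup>2 = h * (1 + Im q) * (Im z * Im z0)"
    using eq(2) y by (simp add: field_simps)
  also have "\<dots> = (Im z0)\<^sup>2 * (1 + Im q) * inverse (1 - Im q)"
    unfolding im using h by (simp add: power2_eq_square divide_inverse)
  finally show "(cmod (z - complex_of_real (Re z0)))\<^sup>2 =
      (Im z0)\<^sup>2 * (1 + Im q) * inverse (1 - Im q)" .
qed

lemma tendsto_real_if_direction:
  assumes z0: "z0 \<in> upper" and z: "\<And>k. z k \<in> upper"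
    and height: "filterlim (\<lambda>k. fst (point_vec z0 (z k))) at_top F"
    and direction: "((\<lambda>k. direction (point_vec z0 (z k))) \<longlongrightarrow> p) F" and "Im p \<noteq> 1"
  shows "(z \<longlongrightarrow> complex_of_real (Re z0 + Im z0 * Re p / (1 - Im p))) F"
proof -
  have "((\<lambda>k. Im (z k)) \<longlongrightarrow> Im z0 * 0 / (1 - Im p)) F"
    unfolding point_eq_of_direction(2)[OF z0 z] using assms(5)
    by (intro tendsto_intros tendsto_inverse_0_at_top height direction) simp
  moreover have "((\<lambda>k. Re (z k)) \<longlongrightarrow> Re z0 + Im z0 * Re p / (1 - Im p)) F"
    unfolding point_eq_of_direction(3)[OF z0 z] using assms(5)
    by (intro tendsto_intros direction) simp
  ultimately show ?thesis by (simp add: tendsto_complex_iff)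
qed

lemma filterlim_at_infinity_if_direction:
  assumes z0: "z0 \<in> upper" and z: "\<And>k. z k \<in> upper"
    and direction: "((\<lambda>k. direction (point_vec z0 (z k))) \<longlongrightarrow> p) F" and "Im p = 1"
  shows "filterlim z at_infinity F"
proof -
  let ?q = "\<lambda>k. direction (point_vec z0 (z k))" and ?c = "complex_of_real (Re z0)"
  have im: "((\<lambda>k. Im (?q k)) \<longlongrightarrow> 1) F" using tendsto_Im[OF direction] assms(4) by simp
  have "((\<lambda>k. 1 - Im (?q k)) \<longlongrightarrow> 1 - 1) F" by (intro tendsto_intros im)
  then have "filterlim (\<lambda>k. 1 - Im (?q k)) (at_right 0) F"
    using point_eq_of_direction(1)[OF z0 z] by (auto simp: filterlim_at less_imp_neq)
  then have "filterlim (\<lambda>k. inverse (1 - Im (?q k))) at_top F"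
    by (rule filterlim_compose[OF filterlim_inverse_at_top_right])
  moreover have "((\<lambda>k. (Im z0)\<^sup>2 * (1 + Im (?q k))) \<longlongrightarrow> (Im z0)\<^sup>2 * (1 + 1)) F"
    by (intro tendsto_intros im)
  moreover have "(Im z0)\<^sup>2 * (1 + 1) > 0" using z0 by (simp add: upper_def)
  ultimately have "filterlim (\<lambda>k. (cmod (z k - ?c))\<^sup>2) at_top F"
    unfolding point_eq_of_direction(4)[OF z0 z] by (intro filterlim_tendsto_pos_mult_at_top)
  then have "filterlim (\<lambda>k. sqrt ((cmod (z k - ?c))\<^sup>2)) at_top F"
    by (rule filterlim_compose[OF sqrt_at_top])
  then have "filterlim (\<lambda>k. z k - ?c) at_infinity F"
    by (intro filterlim_norm_at_top_imp_at_infinity) simp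
  then have "filterlim (\<lambda>k. ?c + (z k - ?c)) at_infinity F"
    by (rule tendsto_add_filterlim_at_infinity[OF tendsto_const])
  then show ?thesis by simp
qed

section \<open>Chains of words and random letters\<close>

lemma monotone_prefix_eq_map:
  fixes u :: "nat \<Rightarrow> 'a list"
  assumes "monotone (\<le>) prefix u"
  shows "\<exists>a. \<forall>m. u m = map a [0..<length (u m)]"
proof (intro exI allI nth_equalityI)
  define a where "a k = u (SOME m. k < length (u m)) ! k" for k
  fix m k assume k: "k < length (u m)"
  define m' where "m' = (SOME m. k < length (u m))"
  have "k < length (u m')" unfolding m'_def by (rule someI[of _ m]) (rule k)
  moreover have "prefix (u m) (u m') \<or> prefix (u m') (u m)"
    using assms by (cases "m \<le> m'") (auto simp: monotone_def)
  ultimately have "u m' ! k = u m ! k" using k by (auto simp: prefix_def nth_append)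
  then show "u m ! k = map a [0..<length (u m)] ! k" using k by (simp add: a_def m'_def)
qed simp

lemma filterlim_length_if_monotone_prefix:
  assumes mono: "monotone (\<le>) prefix u" and unstable: "\<nexists>N. \<forall>m\<ge>N. u m = u N"
  shows "filterlim (\<lambda>m. length (u m)) at_top sequentially"
proof -
  have "\<exists>N. length (u N) \<ge> n" for n
  proof (induction n)
    case (Suc n)
    then obtain N m where N: "length (u N) \<ge> n" "m \<ge> N" "u m \<noteq> u N" using unstable by blast
    then have "strict_prefix (u N) (u m)" using mono by (simp add: strict_prefix_def monotone_def)
    then have "length (u m) \<ge> Suc n" using N(1) prefix_length_less by fastforce
    then show ?case by blast
  qed simp
  moreover have "length (u m) \<le> length (u m')" if "m \<le> m'" for m m'
    using mono that by (simp add: monotone_def prefix_length_le)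
  ultimately have "\<forall>\<^sub>F m in sequentially. n \<le> length (u m)" for n
    unfolding eventually_sequentially by (meson order_trans)
  then show ?thesis by (simp add: filterlim_at_top)
qed

lemma monotone_prefix_limit:
  fixes u :: "nat \<Rightarrow> 'a list"
  assumes "monotone (\<le>) prefix u" "\<nexists>N. \<forall>m\<ge>N. u m = u N"
  obtains a where "\<forall>m. u m = map a [0..<length (u m)]" "\<forall>k. \<exists>m. prefix (map a [0..<k]) (u m)"
proof -
  obtain a where a: "\<forall>m. u m = map a [0..<length (u m)]"
    using monotone_prefix_eq_map[OF assms(1)] by blast
  have "\<exists>m. prefix (map a [0..<k]) (u m)" for k
  proof -
    have "\<forall>\<^sub>F m in sequentially. k \<le> length (u m)"
      using filterlim_length_if_monotone_prefix[OF assms] by (simp add: filterlim_at_top)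
    then obtain m where "k \<le> length (u m)" by (auto simp: eventually_sequentially)
    then have "[0..<length (u m)] = [0..<k] @ [k..<length (u m)]"
      using upt_add_eq_append[of 0 k "length (u m) - k"] by simp
    then have "prefix (map a [0..<k]) (map a [0..<length (u m)])" by simp
    then show ?thesis using a by metis
  qed
  then show ?thesis using that a by blast
qed

lemma AE_PiM_pmf_in_set_pmf:
  "AE \<omega> in \<Pi>\<^sub>M n\<in>(UNIV :: 'i::countable set). measure_pmf p. \<forall>n. \<omega> n \<in> set_pmf p"
proof -
  have "AE \<omega> in \<Pi>\<^sub>M n\<in>(UNIV :: 'i::countable set). measure_pmf p. \<omega> n \<in> set_pmf p" for n
    by (rule AE_PiM_component) (auto simp: measure_pmf.prob_space_axioms AE_measure_pmf)
  then show ?thesis by (simp add: AE_all_countable)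
qed

lemma AE_PiM_pmf_infinitely_often:
  assumes "x \<in> set_pmf p"
  shows "AE \<omega> in \<Pi>\<^sub>M n\<in>(UNIV :: nat set). measure_pmf p. \<exists>\<^sub>\<infinity>n. \<omega> n = x"
proof -
  interpret product_prob_space "\<lambda>_ :: nat. measure_pmf p" UNIV ..
  let ?M = "\<Pi>\<^sub>M n\<in>(UNIV :: nat set). measure_pmf p"
  define q where "q = measure_pmf.prob p (- {x})"
  have "q = 1 - pmf p x"
    using measure_pmf.prob_compl[of "{x}" p]
    by (simp add: q_def measure_pmf_single Compl_eq_Diff_UNIV)
  moreover have "pmf p x > 0" using assms by (rule pmf_positive)
  moreover have "q \<ge> 0" by (simp add: q_def)
  ultimately have "norm q < 1" by simp
  have "AE \<omega> in ?M. \<exists>n\<ge>N. \<omega> n = x" for N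
  proof (rule AE_I)
    define avoid where "avoid J = {\<omega> \<in> space ?M. \<forall>n\<in>J. \<omega> n \<in> - {x}}" for J
    have sets: "avoid J \<in> sets ?M" for J
      unfolding avoid_def by (intro sets.sets_Collect_countable_Ball sets_Collect_single') auto
    show "{\<omega> \<in> space ?M. \<not> (\<exists>n\<ge>N. \<omega> n = x)} \<subseteq> avoid {N..}" by (auto simp: avoid_def)
    have "measure ?M (avoid {N..}) \<le> q ^ k" for k
    proof -
      have "measure ?M (avoid {N..}) \<le> measure ?M (avoid {N..<N + k})"
        using sets by (intro finite_measure_mono) (auto simp: avoid_def)
      also have "emeasure ?M (avoid {N..<N + k}) = ennreal q ^ k"
        unfolding avoid_def
        by (subst emeasure_PiM_Collect) (auto simp: q_def measure_pmf.emeasure_eq_measure)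
      then have "measure ?M (avoid {N..<N + k}) = q ^ k"
        using \<open>q \<ge> 0\<close> by (simp add: measure_def ennreal_power)
      finally show ?thesis .
    qed
    then have "measure ?M (avoid {N..}) \<le> 0"
      using LIMSEQ_le_const[OF LIMSEQ_power_zero[OF \<open>norm q < 1\<close>]] by blast
    then show "emeasure ?M (avoid {N..}) = 0"
      by (simp add: emeasure_eq_measure measure_le_0_iff)
    show "avoid {N..} \<in> sets ?M" by (rule sets)
  qed
  then show ?thesis by (simp add: INFM_nat_le AE_all_countable)
qed

section \<open>The Demazure process of three mirrors\<close>

locale three_mirrors =
  fixes L :: "nat \<Rightarrow> hline" and z0 :: complex
  assumes valid: "\<forall>k \<in> {1,2,3::nat}. valid_line (L k)"
    and z0: "z0 \<in> upper"
    and pairs: "\<forall>i \<in> {1,2,3::nat}. \<forall>i' \<in> {1,2,3::nat}. i \<noteq> i' \<longrightarrow>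
           cond_disjoint (L i) (L i') z0 \<or> cond_angle (L i) (L i') z0"
begin

\<comment> \<open>The simplifier must not turn the \<open>1\<close> in the locale parameter \<open>{1,2,3}\<close> into \<open>Suc 0\<close>.\<close>
declare One_nat_def [simp del]

definition root :: "nat \<Rightarrow> real \<times> complex" where
  "root i = outward_vec z0 (L i)"

lemma pair_coxeter_product:
  assumes "i \<in> {1,2,3}" "j \<in> {1,2,3}" "i \<noteq> j"
  shows "line_form (L i) z0 \<noteq> 0 \<and> coxeter_product (lorentz (root i) (root j))"
  unfolding root_def
  using cond_disjoint_coxeter_product[OF z0, of "L i" "L j"]
    cond_angle_coxeter_product[OF z0, of "L i" "L j"]
    valid pairs assms by blast

lemma line_form_base_nonzero:
  assumes "i \<in> {1,2,3}"
  shows "line_form (L i) z0 \<noteq> 0"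
proof -
  have "\<exists>j\<in>{1,2,3}. i \<noteq> j" by (cases "i = 1") auto
  then show ?thesis using pair_coxeter_product assms by blast
qed

sublocale reflection_chamber root "{1,2,3}"
proof
  fix i :: nat assume i: "i \<in> {1,2,3}"
  then show "lorentz (root i) (root i) = 1" "fst (root i) > 0"
    using valid z0 line_form_base_nonzero[OF i]
    by (auto simp: root_def intro!: lorentz_outward_vec_self fst_outward_vec_pos)
  fix j :: nat assume "j \<in> {1,2,3}" "i \<noteq> j"
  then show "coxeter_product (lorentz (root i) (root j))" using pair_coxeter_product i by blast
qed simp

lemma reflect_root: "i \<in> {1,2,3} \<Longrightarrow> reflect (root i) = reflect (line_vec z0 (L i))"
  unfolding root_def by (intro reflect_outward_vec line_form_base_nonzero)

lemma act_mem_upper: "set w \<subseteq> {1,2,3} \<Longrightarrow> z \<in> upper \<Longrightarrow> act L w z \<in> upper"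
  using valid by (induction w) (auto intro!: refl_mem_upper)

lemma point_vec_act:
  "set w \<subseteq> {1,2,3} \<Longrightarrow> z \<in> upper \<Longrightarrow> point_vec z0 (act L w z) = word_act root w (point_vec z0 z)"
proof (induction w)
  case (Cons i w)
  then have "i \<in> {1,2,3}" "act L w z \<in> upper" using act_mem_upper by auto
  then show ?case using Cons valid z0 by (auto simp: point_vec_refl reflect_root)
qed simp

lemma same_elem_iff:
  assumes "set w \<subseteq> {1,2,3}" "set w' \<subseteq> {1,2,3}"
  shows "same_elem L w w' \<longleftrightarrow> word_act root w = word_act root w'"
proof
  assume same: "same_elem L w w'"
  show "word_act root w = word_act root w'"
  proof (rule linear_eq_if_eq_on_hyperboloid[OF linear_word_act linear_word_act])
    fix v :: "real \<times> complex" assume "v \<in> hyperboloid"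
    then obtain z where "z \<in> upper" "v = point_vec z0 z"
      using bij_betw_imp_surj_on[OF bij_betw_point_vec[OF z0]] by blast
    then show "word_act root w v = word_act root w' v"
      using same point_vec_act[OF assms(1)] point_vec_act[OF assms(2)] by (simp add: same_elem_def)
  qed
next
  assume "word_act root w = word_act root w'"
  then show "same_elem L w w'"
    using inj_onD[OF bij_betw_imp_inj_on[OF bij_betw_point_vec[OF z0]]] act_mem_upper assms
    by (simp add: same_elem_def point_vec_act)
qed

lemma wlen_eq_word_length:
  assumes "set w \<subseteq> {1,2,3}"
  shows "wlen L w = word_length w"
proof -
  have "(\<exists>w'. set w' \<subseteq> {1,2,3} \<and> length w' = n \<and> same_elem L w' w) \<longleftrightarrow>
      (\<exists>w'. set w' \<subseteq> {1,2,3} \<and> length w' = n \<and> word_act root w' = word_act root w)" for n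
    using same_elem_iff[OF _ assms] by blast
  then show ?thesis unfolding wlen_def word_length_def by simp
qed

end

locale demazure_process = three_mirrors +
  fixes idx :: "nat \<Rightarrow> nat"
  assumes idx: "\<And>m. idx m \<in> {1,2,3}"
begin

abbreviation u :: "nat \<Rightarrow> nat list" where
  "u \<equiv> demazure L idx"

lemma set_demazure: "set (u m) \<subseteq> {1,2,3}"
proof (induction m)
  case (Suc m)
  then show ?case using idx[of "Suc m"] by auto
qed simp

lemma set_demazure_snoc: "set (u m @ [idx k]) \<subseteq> {1,2,3}"
  using set_demazure[of m] idx[of k] by simp

lemma demazure_Suc:
  "u (Suc m) =
    (if word_length (u m @ [idx (Suc m)]) > word_length (u m) then u m @ [idx (Suc m)] else u m)"
  unfolding demazure.simps wlen_eq_word_length[OF set_demazure]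
    wlen_eq_word_length[OF set_demazure_snoc] ..

lemma reduced_demazure: "reduced (u m)"
proof (induction m)
  case 0
  show ?case using word_length_le_length[of "[]"] by (simp add: reduced_def)
next
  case (Suc m)
  then show ?case
    using word_length_le_length[OF set_demazure_snoc[of m "Suc m"]]
    by (auto simp: demazure_Suc reduced_def simp del: demazure.simps)
qed

lemma prefix_demazure: "m \<le> m' \<Longrightarrow> prefix (u m) (u m')"
  by (induction rule: dec_induct) auto

lemma monotone_prefix_demazure: "monotone (\<le>) prefix u"
  by (simp add: monotone_def prefix_demazure)

lemma same_elem_demazure_iff:
  assumes "m \<le> m'"
  shows "same_elem L (u m') (u m) \<longleftrightarrow> u m' = u m"
proof
  assume "same_elem L (u m') (u m)"
  then have "word_length (u m') = word_length (u m)"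
    using same_elem_iff set_demazure word_length_cong by blast
  then have "length (u m') = length (u m)" using reduced_demazure by (simp add: reduced_def)
  then show "u m' = u m" using prefix_demazure[OF assms] by (auto simp: prefix_def)
qed (simp add: same_elem_def)

lemma eventually_const_elem_demazure_iff:
  "eventually_const_elem L u \<longleftrightarrow> (\<exists>N. \<forall>m\<ge>N. u m = u N)"
  by (simp add: eventually_const_elem_def same_elem_demazure_iff)

lemma not_eventually_const_if_infinitely_often:
  assumes "\<And>i. i \<in> {1,2,3} \<Longrightarrow> \<exists>\<^sub>\<infinity>m. idx m = i"
  shows "\<not> eventually_const_elem L u"
proof
  assume "eventually_const_elem L u"
  then obtain N where N: "\<And>m. m \<ge> N \<Longrightarrow> u m = u N"
    by (auto simp: eventually_const_elem_demazure_iff)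
  obtain i where i: "i \<in> {1,2,3}" "word_length (u N @ [i]) > word_length (u N)"
    using exists_ascent[OF _ set_demazure] by auto
  then obtain m where m: "m > N" "idx m = i" using assms unfolding INFM_nat by blast
  then obtain k where "m = Suc k" by (cases m) auto
  then have k: "k \<ge> N" "idx (Suc k) = i" using m by auto
  then have "u (Suc k) = u N @ [i]" using N[of k] i by (simp add: demazure_Suc del: demazure.simps)
  then show False using N[of "Suc k"] k(1) by simp
qed

lemma infinite_reduced_word_if_prefixes:
  assumes "\<forall>k. \<exists>m. prefix (map a [0..<k]) (u m)"
  shows "infinite_reduced_word root {1,2,3} a"
proof
  fix k
  obtain m where "prefix (map a [0..<Suc k]) (u m)" using assms by blast
  then have "a k \<in> set (u m)" using set_mono_prefix by fastforce
  then show "a k \<in> {1,2,3}" using set_demazure by blast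
  obtain m y where "u m = map a [0..<k] @ y" using assms unfolding prefix_def by blast
  then show "reduced (map a [0..<k])"
    using reduced_appendD1 set_demazure[of m] reduced_demazure[of m] by metis
qed

theorem demazure_boundary_limit:
  assumes "\<not> eventually_const_elem L u"
  shows "(\<exists>\<zeta>::real. (\<lambda>m. act L (u m) z0) \<longlonglongrightarrow> complex_of_real \<zeta>)
          \<or> filterlim (\<lambda>m. act L (u m) z0) at_infinity sequentially"
proof -
  have unstable: "\<nexists>N. \<forall>m\<ge>N. u m = u N"
    using assms by (simp only: eventually_const_elem_demazure_iff not_False_eq_True)
  obtain a where a: "\<forall>m. u m = map a [0..<length (u m)]" "\<forall>k. \<exists>m. prefix (map a [0..<k]) (u m)"
    using monotone_prefix_limit[OF monotone_prefix_demazure unstable] .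
  interpret ray: infinite_reduced_word root "{1,2,3}" a
    using a(2) by (rule infinite_reduced_word_if_prefixes)
  have vertex: "point_vec z0 (act L (u m) z0) = ray.vertex (length (u m))" for m
    unfolding ray.vertex_def a(1)[rule_format, symmetric]
    by (simp add: point_vec_act[OF set_demazure z0] point_vec_base z0)
  have length: "filterlim (\<lambda>m. length (u m)) at_top sequentially"
    by (rule filterlim_length_if_monotone_prefix[OF monotone_prefix_demazure unstable])
  obtain p where "(\<lambda>k. direction (ray.vertex k)) \<longlonglongrightarrow> p"
    using ray.convergent_direction_vertex by (auto simp: convergent_def)
  from filterlim_compose[OF this length]
  have direction: "(\<lambda>m. direction (point_vec z0 (act L (u m) z0))) \<longlonglongrightarrow> p" unfolding vertex .
  have height: "filterlim (\<lambda>m. fst (point_vec z0 (act L (u m) z0))) at_top sequentially"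
    unfolding vertex by (rule filterlim_compose[OF ray.filterlim_fst_vertex length])
  have upper: "act L (u m) z0 \<in> upper" for m
    using act_mem_upper[OF set_demazure z0] .
  show ?thesis
    using tendsto_real_if_direction[OF z0 upper height direction]
      filterlim_at_infinity_if_direction[OF z0 upper direction] by blast
qed

end

theorem mainTheorem2:
  fixes L :: "nat \<Rightarrow> hline" and z0 :: complex
  assumes "\<forall>k \<in> {1,2,3::nat}. valid_line (L k)"
    and "z0 \<in> upper"
    and "\<forall>i \<in> {1,2,3::nat}. \<forall>i' \<in> {1,2,3::nat}. i \<noteq> i' \<longrightarrow>
           cond_disjoint (L i) (L i') z0 \<or> cond_angle (L i) (L i') z0"
  shows "(AE idx in index_space. \<not> eventually_const_elem L (demazure L idx))
    \<and> (\<forall>idx. (\<forall>m. idx m \<in> {1,2,3}) \<longrightarrow> \<not> eventually_const_elem L (demazure L idx) \<longrightarrow>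
         ((\<exists>\<zeta>::real. (\<lambda>m. act L (demazure L idx m) z0) \<longlonglongrightarrow> complex_of_real \<zeta>)
          \<or> filterlim (\<lambda>m. act L (demazure L idx m) z0) at_infinity sequentially))"
proof -
  interpret three_mirrors L z0 using assms by unfold_locales
  have process: "demazure_process L z0 idx" if "\<forall>m. idx m \<in> {1,2,3}" for idx
    using that by unfold_locales auto
  have "AE idx in index_space. \<forall>m. idx m \<in> {1,2,3}"
    using AE_PiM_pmf_in_set_pmf[of "pmf_of_set {1,2,3::nat}"] unfolding index_space_def by simp
  moreover have "AE idx in index_space. \<forall>i\<in>{1,2,3}. \<exists>\<^sub>\<infinity>m. idx m = i"
    unfolding index_space_def by (intro AE_finite_allI AE_PiM_pmf_infinitely_often) auto
  ultimately have "AE idx in index_space. \<not> eventually_const_elem L (demazure L idx)"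
  proof eventually_elim
    case (elim idx)
    then show ?case
      using demazure_process.not_eventually_const_if_infinitely_often[OF process[OF elim(1)]]
      by blast
  qed
  then show ?thesis using demazure_process.demazure_boundary_limit process by blast
qed

end
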